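(* Let $d \ge 2$, let $\pi$ be an irreducible, type W permutation of $\{1,\dots,d\}$, and let $\lambda_1,\dots,\lambda_d$ be positive lengths with $\lambda_1+\cdots+\lambda_d = 1$ such that the interval exchange transformation $T$ on $[0,1)$ determined by $(\lambda,\pi)$ is linearly recurrent. Then $T$ is mildly mixing with respect to Lebesgue measure on $[0,1)$.
   Context: Interval exchange transformation: given a permutation $\pi$ of $\{1,\dots,d\}$ and positive lengths $\lambda_1,\dots,\lambda_d$ with sum $1$, put $I_i = [\sum_{j<i}\lambda_j, \sum_{j\le i}\lambda_j)$ for $1 \le i \le d$. The interval exchange transformation determined by $(\lambda,\pi)$ is the map $T : [0,1)\to[0,1)$ given by $Tx = x - \sum_{j<i}\lambda_j + \sum_{\pi(j)<\pi(i)}\lambda_j$ for $x \in I_i$. It is an invertible map preserving Lebesgue measure. Irreducible: $\pi$ is irreducible if there is no $1 \le k < d$ with $\pi(\{1,\dots,k\}) = \{1,\dots,k\}$. Type W: define a permutation $\sigma$ of $\{0,1,\dots,d\}$ by $\sigma(0) = \pi^{-1}(1)-1$; $\sigma(j) = d$ if $j \ge 1$ and $\pi(j) = d$; and $\sigma(j) = \pi^{-1}(\pi(j)+1)-1$ for all other $j$. The permutation $\pi$ is type W if $0$ and $d$ lie in distinct orbits (cycles) of $\sigma$. Linearly recurrent: put $\beta_i = \lambda_1+\cdots+\lambda_i$ for $1\le i\le d-1$ and $D = \{\beta_1,\dots,\beta_{d-1}\}$. $T$ satisfies the infinite distinct orbits condition if $D\cap T^{-n}D = \emptyset$ for all $n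 \in \mathbb{N} = \{1,2,\dots\}$. Under this condition, for each $n \in \mathbb{N}$ the set $\bigcup_{0\le i\le n} T^{-i}D$ partitions $[0,1)$ into finitely many sub-intervals of positive length; let $\epsilon_n$ be the length of the shortest one. $T$ is linearly recurrent if it satisfies the infinite distinct orbits condition and $\inf\{n\epsilon_n : n\in\mathbb{N}\} \geq c$ for some constant $c>0$. Rigid: a measure-preserving transformation $S$ of a probability space $(Y,\mathscr{C},\nu)$ is rigid if there is a sequence $n_i \to \infty$ in $\mathbb{N}$ such that $f\circ S^{n_i} \to f$ in $L^2(Y,\mathscr{C},\nu)$ for every $f \in L^2(Y,\mathscr{C},\nu)$. Mildly mixing: a measure-preserving transformation $T$ of a probability space $(X,\mathscr{B},\mu)$ is mildly mixing if it has no non-trivial rigid factors; equivalently, if there is no non-constant $f \in L^2(X,\mathscr{B},\mu)$ for which there is a sequence $n_i\to\infty$ with $f\circ T^{n_i}\to f$ in $L^2(X,\mathscr{B},\mu)$. *)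

theory Defs
  imports "HOL-Probability.Probability" "HOL-Combinatorics.Orbits"
begin

section \<open>Measure-preserving transformations, rigidity and mild mixing\<close>

definition measure_preserving_map :: "'a measure \<Rightarrow> 'b measure \<Rightarrow> ('a \<Rightarrow> 'b) \<Rightarrow> bool" where
  "measure_preserving_map M N f \<longleftrightarrow> f \<in> measurable M N \<and> distr M N f = N"

definition mp_transformation :: "'a measure \<Rightarrow> ('a \<Rightarrow> 'a) \<Rightarrow> bool" where
  "mp_transformation M T \<longleftrightarrow> prob_space M \<and> measure_preserving_map M M T"

definition square_integrable :: "'a measure \<Rightarrow> ('a \<Rightarrow> complex) \<Rightarrow> bool" where
  "square_integrable M f \<longleftrightarrow>
     f \<in> borel_measurable M \<and> integrable M (\<lambda>x. (cmod (f x))\<^sup>2)"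

definition L2_tendsto :: "'a measure \<Rightarrow> (nat \<Rightarrow> 'a \<Rightarrow> complex) \<Rightarrow> ('a \<Rightarrow> complex) \<Rightarrow> bool" where
  "L2_tendsto M F f \<longleftrightarrow>
     (\<lambda>i. \<integral>\<^sup>+x. ennreal ((cmod (F i x - f x))\<^sup>2) \<partial>M) \<longlonglongrightarrow> 0"

definition rigid :: "'a measure \<Rightarrow> ('a \<Rightarrow> 'a) \<Rightarrow> bool" where
  "rigid M S \<longleftrightarrow> mp_transformation M S \<and>
     (\<exists>n :: nat \<Rightarrow> nat. filterlim n at_top sequentially \<and>
        (\<forall>f. square_integrable M f \<longrightarrow> L2_tendsto M (\<lambda>i. f \<circ> (S ^^ n i)) f))"

text \<open>The factor map is total, but it need intertwine the two transformations only almost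
  everywhere; a factor map that is defined only on a set of full measure can be extended
  arbitrarily.\<close>

definition is_factor ::
  "'a measure \<Rightarrow> ('a \<Rightarrow> 'a) \<Rightarrow> 'b measure \<Rightarrow> ('b \<Rightarrow> 'b) \<Rightarrow> bool" where
  "is_factor M T N S \<longleftrightarrow> mp_transformation M T \<and> mp_transformation N S \<and>
     (\<exists>\<phi>. measure_preserving_map M N \<phi> \<and> (AE x in M. \<phi> (T x) = S (\<phi> x)))"

definition trivial_space :: "'a measure \<Rightarrow> bool" where
  "trivial_space N \<longleftrightarrow> (\<forall>C\<in>sets N. measure N C = 0 \<or> measure N C = 1)"

text \<open>A formula of HOL cannot quantify over types, so the type \<open>'b\<close> of the points of the factor
  is a parameter. A theorem concluding \<open>mildly_mixing TYPE('b) M T\<close> for a type variable \<open>'b\<close>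
  holds for all instances of \<open>'b\<close> and therefore excludes non-trivial rigid factors on every
  probability space.\<close>

definition mildly_mixing :: "'b itself \<Rightarrow> 'a measure \<Rightarrow> ('a \<Rightarrow> 'a) \<Rightarrow> bool" where
  "mildly_mixing (_ :: 'b itself) M T \<longleftrightarrow> mp_transformation M T \<and>
     \<not> (\<exists>(N :: 'b measure) S. is_factor M T N S \<and> rigid N S \<and> \<not> trivial_space N)"


section \<open>Permutations\<close>

definition irreducible_perm :: "nat \<Rightarrow> (nat \<Rightarrow> nat) \<Rightarrow> bool" where
  "irreducible_perm d \<pi> \<longleftrightarrow> \<not> (\<exists>k. 1 \<le> k \<and> k < d \<and> \<pi> ` {1..k} = {1..k})"

text \<open>For \<open>\<pi> permutes {1..d}\<close>, the subtractions below do not truncate; outside \<open>{0..d}\<close> the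
  value of \<open>\<sigma>\<close> is irrelevant.\<close>

definition sigma_perm :: "nat \<Rightarrow> (nat \<Rightarrow> nat) \<Rightarrow> nat \<Rightarrow> nat" where
  "sigma_perm d \<pi> j =
     (if j = 0 then inv \<pi> 1 - 1
      else if j > d then j
      else if \<pi> j = d then d
      else inv \<pi> (\<pi> j + 1) - 1)"

definition type_W :: "nat \<Rightarrow> (nat \<Rightarrow> nat) \<Rightarrow> bool" where
  "type_W d \<pi> \<longleftrightarrow> orbit (sigma_perm d \<pi>) 0 \<noteq> orbit (sigma_perm d \<pi>) d"


section \<open>Interval exchange transformations\<close>

definition iet_interval :: "(nat \<Rightarrow> real) \<Rightarrow> nat \<Rightarrow> real set" where
  "iet_interval len i = {(\<Sum>j\<in>{1..<i}. len j) ..< (\<Sum>j\<in>{1..i}. len j)}"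

text \<open>The transformation of \<open>[0,1)\<close> is extended by the identity to the real line.\<close>

definition iet :: "nat \<Rightarrow> (nat \<Rightarrow> nat) \<Rightarrow> (nat \<Rightarrow> real) \<Rightarrow> real \<Rightarrow> real" where
  "iet d \<pi> len x =
     (if x \<in> {0..<1} then
        (let i = (THE i. i \<in> {1..d} \<and> x \<in> iet_interval len i) in
           x - (\<Sum>j\<in>{1..<i}. len j) + (\<Sum>j\<in>{j \<in> {1..d}. \<pi> j < \<pi> i}. len j))
      else x)"

definition iet_D :: "nat \<Rightarrow> (nat \<Rightarrow> real) \<Rightarrow> real set" where
  "iet_D d len = (\<lambda>i. \<Sum>j\<in>{1..i}. len j) ` {1..d - 1}"

definition idoc :: "nat \<Rightarrow> (nat \<Rightarrow> nat) \<Rightarrow> (nat \<Rightarrow> real) \<Rightarrow> bool" where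
  "idoc d \<pi> len \<longleftrightarrow>
     (\<forall>n\<ge>1. iet_D d len \<inter> (iet d \<pi> len ^^ n) -` iet_D d len = {})"

definition division_points :: "nat \<Rightarrow> (nat \<Rightarrow> nat) \<Rightarrow> (nat \<Rightarrow> real) \<Rightarrow> nat \<Rightarrow> real set" where
  "division_points d \<pi> len n =
     {0, 1} \<union> (\<Union>i\<in>{0..n}. {0..<1} \<inter> (iet d \<pi> len ^^ i) -` iet_D d len)"

text \<open>The sub-intervals of the partition are the \<open>[p,q)\<close> with \<open>p < q\<close> consecutive division
  points. There are finitely many of them, because the transformation is injective.\<close>

definition min_length :: "nat \<Rightarrow> (nat \<Rightarrow> nat) \<Rightarrow> (nat \<Rightarrow> real) \<Rightarrow> nat \<Rightarrow> real" where
  "min_length d \<pi> len n =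
     Min {q - p | p q. p \<in> division_points d \<pi> len n \<and> q \<in> division_points d \<pi> len n \<and>
                       p < q \<and> {p<..<q} \<inter> division_points d \<pi> len n = {}}"

definition linearly_recurrent :: "nat \<Rightarrow> (nat \<Rightarrow> nat) \<Rightarrow> (nat \<Rightarrow> real) \<Rightarrow> bool" where
  "linearly_recurrent d \<pi> len \<longleftrightarrow> idoc d \<pi> len \<and>
     (\<exists>c>0. (INF n\<in>{1..}. real n * min_length d \<pi> len n) \<ge> c)"

end

theory Submission
  imports Defs
begin

text \<open>
  By linear recurrence the partition of order \<open>2 n\<close> has gaps of length at least \<open>c / (2 n)\<close>. Hence
  intervals of length \<open>r\<close> of order \<open>c / n\<close> that start at an endpoint travel without being cut, and
  without overlap, for \<open>n\<close> steps, so that they sweep out a set of measure bounded from below.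

  Let \<open>A\<close> satisfy \<open>\<mu>(T\<^sup>-\<^sup>n A \<triangle> A) \<approx> 0\<close> for suitable large \<open>n\<close>. Outside a set of small measure, whether a
  point lies in \<open>A\<close> does not change under a translation by \<open>r\<close>. An endpoint \<open>\<beta>\<^sub>j\<close> in the interior has a
  backward orbit surrounded by uncut intervals, so \<open>A\<close> looks the same on the left and on the right of
  \<open>T\<^sup>-\<^sup>m \<beta>\<^sub>j\<close>; applying \<open>T\<^sup>n\<close>, which almost preserves \<open>A\<close>, it looks the same along the forward orbits of the
  two sides, although these separate. The left side of the endpoint \<open>j\<close> travels next to the right
  side of the endpoint \<open>\<sigma> j\<close>. Going once around the \<open>\<sigma>\<close>-cycle of \<open>0\<close>, which by type W avoids \<open>d\<close>, one returns to
  \<open>0\<close> with a time shift by one, because \<open>T\<close> maps the endpoint \<open>\<sigma> 0\<close> to \<open>0\<close>. So \<open>x\<close> and \<open>T x\<close> agree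
  about \<open>A\<close> for most \<open>x\<close> in a set of measure bounded from below; in the limit, a set of positive measure
  consists of points whose whole forward orbit lies in \<open>A\<close>, or in its complement. As \<open>T\<close> is ergodic,
  \<open>A\<close> is trivial.
\<close>

section \<open>Lebesgue measure on the line\<close>

lemma lmeasurable_interval [simp]: "{a..<b::real} \<in> lmeasurable"
  by (rule bounded_set_imp_lmeasurable) auto

lemma lmeasurable_subset_interval:
  fixes X :: "real set"
  assumes "X \<in> sets lebesgue" "X \<subseteq> {a..<b}"
  shows "X \<in> lmeasurable"
  using assms bounded_subset[of "{a..<b}" X] by (intro bounded_set_imp_lmeasurable) auto

text \<open>Inner regularity gives closed sets \<open>K\<close> inside \<open>A\<close> and
  \<open>L\<close> inside \<open>S - A\<close> that miss little. \<open>K\<close> is compact and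
  disjoint from \<open>L\<close>, so the two lie at a positive distance \<rho>; \<open>R\<close> is
  what they leave over.\<close>

lemma almost_locally_constant:
  fixes A S :: "'a::euclidean_space set"
  assumes A: "A \<in> sets lebesgue" "A \<subseteq> S" and S: "S \<in> sets lebesgue" "bounded S" and "\<eta> > 0"
  obtains R \<rho> where "R \<in> lmeasurable" "measure lebesgue R < \<eta>" "\<rho> > 0"
    "\<And>x y. x \<in> S - R \<Longrightarrow> y \<in> S - R \<Longrightarrow> dist x y < \<rho> \<Longrightarrow> x \<in> A \<longleftrightarrow> y \<in> A"
proof -
  have h: "\<eta> / 2 > 0" using \<open>\<eta> > 0\<close> by simp
  obtain K where K: "closed K" "K \<subseteq> A" "A - K \<in> lmeasurable" "emeasure lebesgue (A - K) < ennreal (\<eta> / 2)"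
    using sets_lebesgue_inner_closed[OF A(1) h] by blast
  have "S - A \<in> sets lebesgue" using A S by auto
  from sets_lebesgue_inner_closed[OF this h] obtain L where
    L: "closed L" "L \<subseteq> S - A" "S - A - L \<in> lmeasurable" "emeasure lebesgue (S - A - L) < ennreal (\<eta> / 2)"
    by blast
  have "compact K" using K A S bounded_subset by (metis compact_eq_bounded_closed)
  moreover have "K \<inter> L = {}" using K L by blast
  ultimately obtain \<rho> where \<rho>: "\<rho> > 0" "\<forall>x\<in>K. \<forall>y\<in>L. \<rho> \<le> dist x y"
    using separate_compact_closed[of K L] L(1) by metis
  show ?thesis
  proof (rule that[of "(A - K) \<union> (S - A - L)" \<rho>])
    show "(A - K) \<union> (S - A - L) \<in> lmeasurable" by (rule fmeasurable.Un[OF K(3) L(3)])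
    have "measure lebesgue (A - K) < \<eta> / 2" "measure lebesgue (S - A - L) < \<eta> / 2"
      using K(4) L(4) unfolding emeasure_eq_measure2[OF K(3)] emeasure_eq_measure2[OF L(3)]
      by (simp_all only: ennreal_less_iff measure_nonneg)
    then show "measure lebesgue ((A - K) \<union> (S - A - L)) < \<eta>"
      using measure_Un_le[of "A - K" lebesgue "S - A - L"] K(3) L(3) by (auto dest: fmeasurableD)
    fix x y assume xy: "x \<in> S - ((A - K) \<union> (S - A - L))" "y \<in> S - ((A - K) \<union> (S - A - L))" "dist x y < \<rho>"
    then have "x \<in> K \<or> x \<in> L" "y \<in> K \<or> y \<in> L" by blast+
    then show "x \<in> A \<longleftrightarrow> y \<in> A"
      using xy(3) \<rho>(2)[rule_format, of x y] \<rho>(2)[rule_format, of y x] K(2) L(2)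
      by (auto simp: dist_commute)
  qed (use \<rho> in auto)
qed

section \<open>Comparing a set on several intervals of the same length\<close>

text \<open>The part of \<open>R\<close> in [a, a + r), moved back to [0, r), so that what is seen
  on different intervals becomes a subset of one parameter interval.\<close>

definition window :: "real \<Rightarrow> real \<Rightarrow> real set \<Rightarrow> real set" where
  "window a r R = {t \<in> {0..<r}. a + t \<in> R}"

lemma window_iff: "t \<in> window a r R \<longleftrightarrow> 0 \<le> t \<and> t < r \<and> a + t \<in> R"
  by (auto simp: window_def)

lemma window_translate: "window a r R = (\<lambda>x. x - a) ` (R \<inter> {a..<a + r})"
proof (rule set_eqI)
  fix t
  show "t \<in> window a r R \<longleftrightarrow> t \<in> (\<lambda>x. x - a) ` (R \<inter> {a..<a + r})"
    by (force simp: window_def image_iff intro: bexI[of _ "a + t"])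
qed

lemma lmeasurable_window:
  assumes "R \<in> sets lebesgue"
  shows "window a r R \<in> lmeasurable"
proof -
  have "{a..<a + r} \<inter> R \<in> lmeasurable"
    using assms by (intro bounded_set_imp_lmeasurable bounded_Int) auto
  then show ?thesis by (simp add: window_translate measurable_translation_subtract Int_commute)
qed

lemma measure_window: "measure lebesgue (window a r R) = measure lebesgue (R \<inter> {a..<a + r})"
  by (simp add: window_translate measure_translation_subtract)

text \<open>Starting points at distance at least \<open>r\<close> give disjoint intervals, so the
  windows account for disjoint parts of \<open>R\<close>. Thus a small set is small on average over
  many windows.\<close>

lemma sum_measure_window_le:
  assumes "finite K" and R: "R \<in> lmeasurable"
    and sep: "\<And>i j. i \<in> K \<Longrightarrow> j \<in> K \<Longrightarrow> i \<noteq> j \<Longrightarrow> r \<le> \<bar>a i - a j\<bar>"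
  shows "(\<Sum>k\<in>K. measure lebesgue (window (a k) r R)) \<le> measure lebesgue R"
proof -
  have meas: "R \<inter> {a k..<a k + r} \<in> lmeasurable" for k
    using R by (intro fmeasurable_Int_fmeasurable) auto
  have "(\<Sum>k\<in>K. measure lebesgue (window (a k) r R)) = (\<Sum>k\<in>K. measure lebesgue (R \<inter> {a k..<a k + r}))"
    by (simp add: measure_window)
  also have "\<dots> = measure lebesgue (\<Union>k\<in>K. R \<inter> {a k..<a k + r})"
  proof (rule measure_UNION'[symmetric, OF \<open>finite K\<close> meas])
    show "pairwise (\<lambda>i j. disjnt (R \<inter> {a i..<a i + r}) (R \<inter> {a j..<a j + r})) K"
      using sep by (force simp: pairwise_def disjnt_def abs_real_def split: if_splits)
  qed
  also have "\<dots> \<le> measure lebesgue R"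
    by (rule measure_mono_fmeasurable) (use R meas \<open>finite K\<close> in \<open>auto intro!: sets.finite_UN\<close>)
  finally show ?thesis .
qed

text \<open>Its measure is a pseudometric in \<open>a\<close> and \<open>b\<close>, which tells how
  much the patterns of \<open>A\<close> to the right of the two points differ; this is what allows
  chains of comparisons.\<close>

definition mismatch :: "real \<Rightarrow> real set \<Rightarrow> real \<Rightarrow> real \<Rightarrow> real set" where
  "mismatch r A a b = {t \<in> {0..<r}. (a + t \<in> A) \<noteq> (b + t \<in> A)}"

lemma lmeasurable_mismatch:
  assumes "A \<in> sets lebesgue"
  shows "mismatch r A a b \<in> lmeasurable"
proof -
  have "mismatch r A a b = (window a r A - window b r A) \<union> (window b r A - window a r A)"
    by (auto simp: mismatch_def window_iff)
  then show ?thesis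
    by (simp add: fmeasurable.Un fmeasurable_Diff lmeasurable_window[OF assms] fmeasurableD)
qed

lemma measure_mismatch_triangle:
  assumes "A \<in> sets lebesgue"
  shows "measure lebesgue (mismatch r A a e) \<le> measure lebesgue (mismatch r A a b) + measure lebesgue (mismatch r A b e)"
proof -
  note meas = lmeasurable_mismatch[OF assms]
  have "measure lebesgue (mismatch r A a e) \<le> measure lebesgue (mismatch r A a b \<union> mismatch r A b e)"
    by (rule measure_mono_fmeasurable[OF _ fmeasurableD[OF meas] fmeasurable.Un[OF meas meas]])
      (auto simp: mismatch_def)
  also have "\<dots> \<le> measure lebesgue (mismatch r A a b) + measure lebesgue (mismatch r A b e)"
    by (intro measure_Un_le fmeasurableD meas)
  finally show ?thesis .
qed

lemma emeasure_translated:
  assumes "A \<in> sets lebesgue"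
  shows "{x. x + s \<in> A} \<in> sets lebesgue" "emeasure lebesgue {x. x + s \<in> A} = emeasure lebesgue (A :: real set)"
proof -
  have eq: "{x. x + s \<in> A} = (+) (- s) ` A"
    by (auto simp: image_iff intro!: bexI[of _ "_ + s"])
  show "{x. x + s \<in> A} \<in> sets lebesgue"
    unfolding eq by (rule lebesgue_sets_translation[OF assms])
  show "emeasure lebesgue {x. x + s \<in> A} = emeasure lebesgue A"
    using emeasure_lebesgue_affine[of 1 "- s" A] unfolding eq by (simp add: add.commute[of _ "- s"])
qed

lemma measure_split_intervals:
  assumes X: "X \<in> sets lebesgue" "X \<subseteq> {0..<1}" and N: "N \<ge> 1"
  shows "measure lebesgue X = (\<Sum>i<N. measure lebesgue (X \<inter> {real i / real N..<real i / real N + 1 / real N}))"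
proof -
  let ?I = "\<lambda>i. {real i / real N..<real i / real N + 1 / real N}"
  have in_I: "x \<in> ?I i \<longleftrightarrow> real i \<le> real N * x \<and> real N * x < real i + 1" for x i
    using N by (auto simp: field_simps)
  have un: "(\<Union>i<N. X \<inter> ?I i) = X"
  proof
    show "X \<subseteq> (\<Union>i<N. X \<inter> ?I i)"
    proof
      fix x assume x: "x \<in> X"
      then have x01: "0 \<le> x" "x < 1" using X by auto
      define i where "i = nat \<lfloor>real N * x\<rfloor>"
      have "0 \<le> real N * x" using x01 by simp
      then have i: "real i \<le> real N * x" "real N * x < real i + 1"
        by (auto simp: i_def)
      have "real N * x < real N" using x01 N by simp
      then have "i < N" using i by linarith
      then show "x \<in> (\<Union>i<N. X \<inter> ?I i)" using x i in_I[of x i] by blast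
    qed
  qed auto
  have "measure lebesgue (\<Union>i<N. X \<inter> ?I i) = (\<Sum>i<N. measure lebesgue (X \<inter> ?I i))"
  proof (rule measure_UNION')
    show "X \<inter> ?I i \<in> lmeasurable" for i
      using X by (intro bounded_set_imp_lmeasurable bounded_Int) auto
    have disj: "False" if "x \<in> ?I i" "x \<in> ?I j" "i < j" for x i j
    proof -
      have "real i + 1 \<le> real j" using that by simp
      moreover have "real N * x < real i + 1" "real j \<le> real N * x"
        using that(1,2) unfolding in_I by simp_all
      ultimately show False by linarith
    qed
    show "pairwise (\<lambda>i j. disjnt (X \<inter> ?I i) (X \<inter> ?I j)) {..<N}"
    proof (rule pairwiseI)
      fix i j :: nat assume "i \<noteq> j"
      then show "disjnt (X \<inter> ?I i) (X \<inter> ?I j)"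
        using disj[of _ i j] disj[of _ j i] unfolding disjnt_iff Int_iff by (metis linorder_neqE_nat)
    qed
  qed simp
  then show ?thesis unfolding un .
qed

section \<open>Interval exchange transformations\<close>

text \<open>The points \<beta> of the statement, completed by 0 at index 0 and 1 at index
  \<open>d\<close>; the indices 0, ..., d are those that \<sigma> permutes.\<close>

definition endpoint :: "(nat \<Rightarrow> real) \<Rightarrow> nat \<Rightarrow> real" where
  "endpoint len i = (\<Sum>j\<in>{1..i}. len j)"

lemma endpoint_0 [simp]: "endpoint len 0 = 0"
  by (simp add: endpoint_def)

lemma endpoint_Suc: "endpoint len (Suc i) = endpoint len i + len (Suc i)"
  by (simp add: endpoint_def)

lemma endpoint_pred:
  assumes "i \<ge> 1"
  shows "endpoint len i = endpoint len (i - 1) + len i"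
  using endpoint_Suc[of len "i - 1"] assms by simp

lemma iet_interval_endpoint:
  assumes "i \<ge> 1"
  shows "iet_interval len i = {endpoint len (i - 1)..<endpoint len i}"
proof -
  have "{1..<i} = {1..i - 1}" using assms by auto
  then show ?thesis by (simp add: iet_interval_def endpoint_def)
qed

section \<open>The partition of the unit interval given by the lengths\<close>

locale length_vector =
  fixes d :: nat and len :: "nat \<Rightarrow> real"
  assumes len_pos: "\<And>i. i \<in> {1..d} \<Longrightarrow> len i > 0"
    and len_total: "(\<Sum>i\<in>{1..d}. len i) = 1"
begin

lemma endpoint_top [simp]: "endpoint len d = 1"
  using len_total by (simp add: endpoint_def)

lemma endpoint_strict_mono: "i < j \<Longrightarrow> j \<le> d \<Longrightarrow> endpoint len i < endpoint len j"
proof (induction j)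
  case (Suc j)
  have "len (Suc j) > 0" using Suc.prems len_pos by auto
  then show ?case
    using Suc by (cases "i = j") (auto simp: endpoint_Suc)
qed simp

lemma endpoint_mono: "i \<le> j \<Longrightarrow> j \<le> d \<Longrightarrow> endpoint len i \<le> endpoint len j"
  using endpoint_strict_mono[of i j] by (cases "i = j") auto

lemma endpoint_nonneg: "i \<le> d \<Longrightarrow> 0 \<le> endpoint len i"
  using endpoint_mono[of 0 i] by simp

lemma endpoint_le_1: "i \<le> d \<Longrightarrow> endpoint len i \<le> 1"
  using endpoint_mono[of i d] by simp

lemma endpoint_less_1: "i < d \<Longrightarrow> endpoint len i < 1"
  using endpoint_strict_mono[of i d] by simp

lemma iet_interval_subset: "i \<in> {1..d} \<Longrightarrow> iet_interval len i \<subseteq> {0..<1}"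
proof -
  assume i: "i \<in> {1..d}"
  then have "0 \<le> endpoint len (i - 1)" "endpoint len i \<le> 1"
    by (auto intro: endpoint_nonneg endpoint_le_1)
  then show ?thesis using i by (simp add: iet_interval_endpoint)
qed

lemma iet_interval_unique:
  assumes "i \<in> {1..d}" "j \<in> {1..d}" "x \<in> iet_interval len i" "x \<in> iet_interval len j"
  shows "i = j"
proof (rule ccontr)
  have aux: False if "a \<in> {1..d}" "b \<in> {1..d}" "a < b" "x \<in> iet_interval len a"
      "x \<in> iet_interval len b" for a b
  proof -
    have "endpoint len a \<le> endpoint len (b - 1)" using that by (intro endpoint_mono) auto
    then show False using that by (simp add: iet_interval_endpoint)
  qed
  assume "i \<noteq> j"
  then show False using aux[of i j] aux[of j i] assms by (cases "i < j") auto
qed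

lemma iet_interval_exists:
  assumes "x \<in> {0..<1}"
  obtains i where "i \<in> {1..d}" "x \<in> iet_interval len i"
proof -
  define i where "i = (LEAST i. x < endpoint len i)"
  have d: "x < endpoint len d" using assms by simp
  have i: "x < endpoint len i" "i \<le> d" unfolding i_def using d by (rule LeastI, rule Least_le)
  have "i \<noteq> 0" using i assms by (intro notI) simp
  moreover have "\<not> x < endpoint len (i - 1)"
    using not_less_Least[of "i - 1" "\<lambda>i. x < endpoint len i"] \<open>i \<noteq> 0\<close> by (simp add: i_def)
  ultimately show ?thesis using i that[of i] by (auto simp: iet_interval_endpoint)
qed

end

section \<open>The exchange as a bijection preserving Lebesgue measure\<close>

locale interval_exchange = length_vector +
  fixes \<pi> :: "nat \<Rightarrow> nat"
  assumes perm: "\<pi> permutes {1..d}"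
begin

abbreviation T :: "real \<Rightarrow> real" where "T \<equiv> iet d \<pi> len"

text \<open>Read from left to right, the image intervals have the lengths
  \<open>len \<circ> inv \<pi>\<close>, and the image of interval \<open>i\<close> is number
  \<open>\<pi> i\<close> among them. The shift is the difference of the two left ends.\<close>

definition shift :: "nat \<Rightarrow> real" where
  "shift i = endpoint (len \<circ> inv \<pi>) (\<pi> i - 1) - endpoint len (i - 1)"

lemma perm_in: "i \<in> {1..d} \<Longrightarrow> \<pi> i \<in> {1..d}"
  using permutes_in_image[OF perm] by blast

lemma image_sum:
  assumes "i \<in> {1..d}"
  shows "(\<Sum>j\<in>{j \<in> {1..d}. \<pi> j < \<pi> i}. len j) = endpoint (len \<circ> inv \<pi>) (\<pi> i - 1)"
  unfolding endpoint_def
proof (rule sum.reindex_bij_witness[of _ "inv \<pi>" \<pi>])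
  fix q assume q: "q \<in> {1..\<pi> i - 1}"
  have "q \<in> {1..d}" using q perm_in[OF assms] by auto
  then show "inv \<pi> q \<in> {j \<in> {1..d}. \<pi> j < \<pi> i}"
    using q permutes_in_image[OF permutes_inv[OF perm], of q] permutes_inverses(1)[OF perm] by auto
qed (use permutes_inverses[OF perm] perm_in in \<open>force+\<close>)

lemma iet_on_interval:
  assumes "i \<in> {1..d}" "x \<in> iet_interval len i"
  shows "T x = x + shift i"
proof -
  have x: "x \<in> {0..<1}" using iet_interval_subset assms by blast
  have the: "(THE i. i \<in> {1..d} \<and> x \<in> iet_interval len i) = i"
    using assms iet_interval_unique by (intro the_equality) auto
  have "{1..<i} = {1..i - 1}" using assms by auto
  then show ?thesis
    using x image_sum[OF assms(1)] unfolding iet_def shift_def the Let_def endpoint_def by simp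
qed

lemma iet_outside: "x \<notin> {0..<1} \<Longrightarrow> T x = x"
  by (auto simp: iet_def)

text \<open>Exchanging the image intervals back is again an interval exchange, so facts about image
  intervals follow from those about the original ones.\<close>

lemma inverse_interval_exchange: "interval_exchange d (len \<circ> inv \<pi>) (inv \<pi>)"
proof
  fix i assume "i \<in> {1..d}"
  then show "(len \<circ> inv \<pi>) i > 0"
    using permutes_in_image[OF permutes_inv[OF perm], of i] len_pos by auto
next
  show "(\<Sum>i\<in>{1..d}. (len \<circ> inv \<pi>) i) = 1"
    using sum.permute[OF permutes_inv[OF perm], of len] len_total by (simp add: comp_def)
next
  show "inv \<pi> permutes {1..d}" by (rule permutes_inv[OF perm])
qed

lemma iet_image_interval:
  assumes "i \<in> {1..d}"
  shows "x \<in> iet_interval len i \<longleftrightarrow> x + shift i \<in> iet_interval (len \<circ> inv \<pi>) (\<pi> i)"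
proof -
  have "endpoint (len \<circ> inv \<pi>) (\<pi> i) = endpoint (len \<circ> inv \<pi>) (\<pi> i - 1) + len i"
    using endpoint_pred[of "\<pi> i" "len \<circ> inv \<pi>"] perm_in[OF assms] permutes_inverses[OF perm] by auto
  then show ?thesis
    using assms perm_in[OF assms] endpoint_pred[of i len]
    by (auto simp: iet_interval_endpoint shift_def)
qed

lemma iet_range: "x \<in> {0..<1} \<Longrightarrow> T x \<in> {0..<1}"
proof -
  assume "x \<in> {0..<1}"
  then obtain i where i: "i \<in> {1..d}" "x \<in> iet_interval len i" by (rule iet_interval_exists)
  interpret inverse: interval_exchange d "len \<circ> inv \<pi>" "inv \<pi>" by (rule inverse_interval_exchange)
  show ?thesis
    using iet_on_interval[OF i] iet_image_interval[OF i(1), of x] i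
      inverse.iet_interval_subset[OF perm_in[OF i(1)]] by auto
qed

lemma iet_left_inverse: "iet d (inv \<pi>) (len \<circ> inv \<pi>) (T x) = x"
proof (cases "x \<in> {0..<1}")
  case True
  then obtain i where i: "i \<in> {1..d}" "x \<in> iet_interval len i" by (rule iet_interval_exists)
  interpret inverse: interval_exchange d "len \<circ> inv \<pi>" "inv \<pi>" by (rule inverse_interval_exchange)
  have eq: "len \<circ> inv \<pi> \<circ> \<pi> = len" using permutes_inv_o[OF perm] by (simp add: comp_assoc)
  have "inverse.shift (\<pi> i) = - shift i"
    using permutes_inverses[OF perm] permutes_inv_inv[OF perm] eq
    by (simp add: inverse.shift_def shift_def)
  then show ?thesis
    using inverse.iet_on_interval[OF perm_in[OF i(1)], of "T x"] iet_on_interval[OF i]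
      iet_image_interval[OF i(1), of x] i by auto
next
  case False
  then show ?thesis by (auto simp: iet_def)
qed

lemma iet_right_inverse: "T (iet d (inv \<pi>) (len \<circ> inv \<pi>) x) = x"
proof -
  interpret inverse: interval_exchange d "len \<circ> inv \<pi>" "inv \<pi>" by (rule inverse_interval_exchange)
  have "len \<circ> inv \<pi> \<circ> \<pi> = len" using permutes_inv_o[OF perm] by (simp add: comp_assoc)
  then show ?thesis using inverse.iet_left_inverse[of x] permutes_inv_inv[OF perm] by simp
qed

text \<open>Through the extension by the identity, \<open>T\<close> is a bijection of the whole
  line, so \<open>inv (T ^^ m)\<close> gives backward orbits without a restriction of the
  domain.\<close>

lemma bij_iet: "bij T"
  by (rule bij_betw_byWitness[where f' = "iet d (inv \<pi>) (len \<circ> inv \<pi>)"])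
    (auto simp: iet_left_inverse iet_right_inverse)

lemma bij_iet_funpow: "bij (T ^^ n)"
  using bij_iet by (rule bij_fn)

lemma iet_funpow_inject [simp]: "(T ^^ n) x = (T ^^ n) y \<longleftrightarrow> x = y"
  by (rule inj_eq[OF bij_is_inj[OF bij_iet_funpow]])

lemma iet_range_iff: "T x \<in> {0..<1} \<longleftrightarrow> x \<in> {0..<1}"
  using iet_range iet_outside by metis

lemma iet_funpow_range_iff: "(T ^^ n) x \<in> {0..<1} \<longleftrightarrow> x \<in> {0..<1}"
proof (induction n)
  case (Suc n)
  then show ?case using iet_range_iff[of "(T ^^ n) x"] by simp
qed simp

lemma vimage_iet_eq: "T -` A \<inter> {0..<1} = (\<Union>i\<in>{1..d}. {x. x + shift i \<in> A \<inter> iet_interval (len \<circ> inv \<pi>) (\<pi> i)})"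
  (is "?L = ?R")
proof (rule set_eqI)
  fix x
  show "x \<in> ?L \<longleftrightarrow> x \<in> ?R"
  proof
    assume "x \<in> ?L"
    then obtain i where "i \<in> {1..d}" "x \<in> iet_interval len i" using iet_interval_exists by auto
    then show "x \<in> ?R" using iet_on_interval iet_image_interval \<open>x \<in> ?L\<close> by auto
  next
    assume "x \<in> ?R"
    then obtain i where "i \<in> {1..d}" "x + shift i \<in> A" "x \<in> iet_interval len i"
      using iet_image_interval by auto
    then show "x \<in> ?L" using iet_on_interval[of i x] iet_interval_subset[of i] by auto
  qed
qed

text \<open>The preimage consists of translates of the pieces that the image intervals cut out of
  \<open>A\<close>. Both the pieces and their translates are disjoint, and translations preserve
  measure.\<close>

lemma emeasure_vimage_iet:
  assumes A: "A \<in> sets lebesgue" "A \<subseteq> {0..<1}"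
  shows "T -` A \<inter> {0..<1} \<in> sets lebesgue"
    and "emeasure lebesgue (T -` A \<inter> {0..<1}) = emeasure lebesgue A"
proof -
  interpret inverse: interval_exchange d "len \<circ> inv \<pi>" "inv \<pi>" by (rule inverse_interval_exchange)
  let ?J = "\<lambda>i. iet_interval (len \<circ> inv \<pi>) (\<pi> i)"
  let ?S = "\<lambda>i. {x. x + shift i \<in> A \<inter> ?J i}"
  have J: "A \<inter> ?J i \<in> sets lebesgue" if "i \<in> {1..d}" for i
    using A that perm_in[OF that] by (auto simp: iet_interval_endpoint)
  have S: "?S i \<in> sets lebesgue" "emeasure lebesgue (?S i) = emeasure lebesgue (A \<inter> ?J i)"
    if "i \<in> {1..d}" for i
    using emeasure_translated[OF J[OF that], of "shift i"] by simp_all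
  show "T -` A \<inter> {0..<1} \<in> sets lebesgue"
    unfolding vimage_iet_eq by (rule sets.finite_UN) (simp_all only: S finite_atLeastAtMost)
  have disj: "disjoint_family_on ?S {1..d}"
  proof (unfold disjoint_family_on_def, intro ballI impI)
    fix i j assume ij: "i \<in> {1..d}" "j \<in> {1..d}" "i \<noteq> j"
    have "False" if "x \<in> ?S i" "x \<in> ?S j" for x
      using that iet_image_interval[OF ij(1), of x] iet_image_interval[OF ij(2), of x]
        iet_interval_unique[of i j x] ij by auto
    then show "?S i \<inter> ?S j = {}" by blast
  qed
  have disjJ: "disjoint_family_on (\<lambda>i. A \<inter> ?J i) {1..d}"
  proof (unfold disjoint_family_on_def, intro ballI impI)
    fix i j assume ij: "i \<in> {1..d}" "j \<in> {1..d}" "i \<noteq> j"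
    have "\<pi> i \<noteq> \<pi> j" using ij permutes_inj[OF perm] by (auto simp: inj_eq)
    then show "A \<inter> ?J i \<inter> (A \<inter> ?J j) = {}"
      using inverse.iet_interval_unique[OF perm_in[OF ij(1)] perm_in[OF ij(2)]] by blast
  qed
  have un: "(\<Union>i\<in>{1..d}. A \<inter> ?J i) = A"
  proof
    show "A \<subseteq> (\<Union>i\<in>{1..d}. A \<inter> ?J i)"
    proof
      fix x assume x: "x \<in> A"
      then obtain q where q: "q \<in> {1..d}" "x \<in> iet_interval (len \<circ> inv \<pi>) q"
        using A inverse.iet_interval_exists by blast
      have "inv \<pi> q \<in> {1..d}" "\<pi> (inv \<pi> q) = q"
        using inverse.perm_in[OF q(1)] permutes_inverses[OF perm] by auto
      then show "x \<in> (\<Union>i\<in>{1..d}. A \<inter> ?J i)" using x q by (intro UN_I[of "inv \<pi> q"]) auto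
    qed
  qed auto
  have "emeasure lebesgue (T -` A \<inter> {0..<1}) = (\<Sum>i\<in>{1..d}. emeasure lebesgue (?S i))"
    unfolding vimage_iet_eq
    by (rule sum_emeasure[symmetric]) (use S(1) disj in \<open>auto simp only: image_subset_iff finite_atLeastAtMost\<close>)
  also have "\<dots> = (\<Sum>i\<in>{1..d}. emeasure lebesgue (A \<inter> ?J i))"
    by (rule sum.cong[OF refl S(2)])
  also have "\<dots> = emeasure lebesgue (\<Union>i\<in>{1..d}. A \<inter> ?J i)"
    by (rule sum_emeasure) (use J disjJ in auto)
  finally show "emeasure lebesgue (T -` A \<inter> {0..<1}) = emeasure lebesgue A"
    unfolding un .
qed

lemma mp_transformation_iet: "mp_transformation (lebesgue_on {0..<1}) T"
proof -
  let ?M = "lebesgue_on {0..<1::real}"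
  have sub: "A \<in> sets lebesgue \<and> A \<subseteq> {0..<1}" if "A \<in> sets ?M" for A
    using that by (simp add: sets_restrict_space_iff)
  have meas: "T \<in> measurable ?M ?M"
  proof (rule measurableI)
    fix A assume A: "A \<in> sets ?M"
    then show "T -` A \<inter> space ?M \<in> sets ?M"
      using emeasure_vimage_iet(1)[of A] sub[OF A] by (simp add: sets_restrict_space_iff)
  next
    fix x assume "x \<in> space ?M"
    then show "T x \<in> space ?M" using iet_range[of x] by simp
  qed
  have "distr ?M ?M T = ?M"
  proof (rule measure_eqI)
    fix A assume "A \<in> sets (distr ?M ?M T)"
    then have A: "A \<in> sets ?M" by simp
    then show "emeasure (distr ?M ?M T) A = emeasure ?M A"
      using emeasure_vimage_iet[of A] sub[OF A]
      by (simp add: emeasure_distr[OF meas A] emeasure_restrict_space)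
  qed simp
  moreover have "prob_space ?M"
    by (rule prob_spaceI) (simp add: emeasure_restrict_space)
  ultimately show ?thesis
    using meas by (simp add: mp_transformation_def measure_preserving_map_def)
qed

end

section \<open>Gaps of the partitions and travelling intervals\<close>

locale idoc_interval_exchange = interval_exchange +
  assumes d_ge_2: "d \<ge> 2"
    and irreducible: "irreducible_perm d \<pi>"
    and infinite_distinct_orbits: "idoc d \<pi> len"
begin

abbreviation D :: "real set" where "D \<equiv> iet_D d len"

abbreviation gap :: "nat \<Rightarrow> real" where "gap \<equiv> min_length d \<pi> len"

lemma D_iff: "x \<in> D \<longleftrightarrow> (\<exists>j. 1 \<le> j \<and> j < d \<and> x = endpoint len j)"
proof -
  have "{1..d - 1} = {j. 1 \<le> j \<and> j < d}" using d_ge_2 by auto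
  then show ?thesis by (auto simp: iet_D_def endpoint_def)
qed

lemma endpoint_in_D: "1 \<le> j \<Longrightarrow> j < d \<Longrightarrow> endpoint len j \<in> D"
  unfolding D_iff by blast

lemma D_bounds: "x \<in> D \<Longrightarrow> 0 < x \<and> x < 1"
  using endpoint_strict_mono[of 0] endpoint_less_1 by (auto simp: D_iff)

lemma funpow_iet_D: "x \<in> D \<Longrightarrow> n \<ge> 1 \<Longrightarrow> (T ^^ n) x \<notin> D"
  using infinite_distinct_orbits by (auto simp: idoc_def)

text \<open>Of two visits, the later one would be a return of a point of \<open>D\<close> to
  \<open>D\<close>.\<close>

lemma hits_D_once:
  assumes "(T ^^ i) x \<in> D" "(T ^^ j) x \<in> D"
  shows "i = j"
proof (rule ccontr)
  have aux: False if "a < b" "(T ^^ a) x \<in> D" "(T ^^ b) x \<in> D" for a b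
  proof -
    have "(T ^^ b) x = (T ^^ (b - a)) ((T ^^ a) x)"
      using that by (simp flip: funpow_add[THEN fun_cong, unfolded comp_apply])
    then show False using funpow_iet_D[OF that(2), of "b - a"] that by simp
  qed
  assume "i \<noteq> j"
  then show False using aux[of i j] aux[of j i] assms by (cases "i < j") auto
qed

text \<open>Interval number \<open>inv \<pi> (\<pi> j + 1)\<close> has its image directly to the
  right of the image of interval \<open>j\<close>. Its left end has index \<sigma> j, whence the
  subtraction of 1 in \<sigma>, and is sent to the common boundary of the two images.\<close>

lemma iet_sigma:
  assumes "j \<in> {1..d}" "\<pi> j \<noteq> d"
  shows "sigma_perm d \<pi> j < d"
    and "T (endpoint len (sigma_perm d \<pi> j)) = endpoint (len \<circ> inv \<pi>) (\<pi> j)"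
proof -
  define i where "i = inv \<pi> (\<pi> j + 1)"
  have "\<pi> j + 1 \<in> {1..d}" using perm_in[OF assms(1)] assms(2) by auto
  then have i: "i \<in> {1..d}" "\<pi> i = \<pi> j + 1"
    using permutes_in_image[OF permutes_inv[OF perm]] permutes_inverses(1)[OF perm]
    by (auto simp: i_def)
  have s: "sigma_perm d \<pi> j = i - 1" using assms by (auto simp: sigma_perm_def i_def)
  show "sigma_perm d \<pi> j < d" using i s by auto
  have "endpoint len (i - 1) \<in> iet_interval len i"
    using i(1) endpoint_strict_mono[of "i - 1" i] by (simp add: iet_interval_endpoint)
  then show "T (endpoint len (sigma_perm d \<pi> j)) = endpoint (len \<circ> inv \<pi>) (\<pi> j)"
    using iet_on_interval[OF i(1)] i(2) by (simp add: s shift_def)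
qed

text \<open>The interval whose image is leftmost begins at endpoint \<sigma> 0. Irreducibility
  prevents the first interval from staying first, so this endpoint is an interior one.\<close>

lemma iet_sigma_0:
  shows "sigma_perm d \<pi> 0 \<in> {1..<d}" and "T (endpoint len (sigma_perm d \<pi> 0)) = 0"
proof -
  define i where "i = inv \<pi> 1"
  have "1 \<in> {1..d}" using d_ge_2 by simp
  then have i: "i \<in> {1..d}" "\<pi> i = 1"
    using permutes_in_image[OF permutes_inv[OF perm]] permutes_inverses(1)[OF perm]
    by (auto simp: i_def)
  have "i \<noteq> 1"
  proof
    assume "i = 1"
    then have "\<pi> ` {1..1} = {1..1}" using i by simp
    moreover have "1 \<le> (1::nat)" "1 < d" using d_ge_2 by auto
    ultimately show False using irreducible unfolding irreducible_perm_def by blast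
  qed
  then show "sigma_perm d \<pi> 0 \<in> {1..<d}" using i(1) by (auto simp: sigma_perm_def i_def)
  have "endpoint len (i - 1) \<in> iet_interval len i"
    using i(1) endpoint_strict_mono[of "i - 1" i] by (simp add: iet_interval_endpoint)
  then show "T (endpoint len (sigma_perm d \<pi> 0)) = 0"
    using iet_on_interval[OF i(1)] i(2) i_def by (simp add: sigma_perm_def shift_def)
qed

text \<open>0 is the image of a point of \<open>D\<close>, so its forward orbit is part of a forward
  orbit that starts in \<open>D\<close>.\<close>

lemma zero_never_hits_D: "(T ^^ n) 0 \<notin> D"
proof -
  have "endpoint len (sigma_perm d \<pi> 0) \<in> D"
    using iet_sigma_0(1) by (auto simp: D_iff)
  from funpow_iet_D[OF this, of "Suc n"] show ?thesis
    unfolding funpow_Suc_right comp_apply iet_sigma_0(2) by simp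
qed

text \<open>By injectivity a period of 0 would also be a period of its preimage in
  \<open>D\<close>.\<close>

lemma zero_aperiodic:
  assumes "m \<ge> 1"
  shows "(T ^^ m) 0 \<noteq> 0"
proof
  define b where "b = endpoint len (sigma_perm d \<pi> 0)"
  have b: "b \<in> D" "T b = 0"
    using iet_sigma_0 by (auto simp: D_iff b_def)
  assume "(T ^^ m) 0 = 0"
  then have "(T ^^ Suc m) b = (T ^^ 1) b"
    unfolding funpow_Suc_right comp_apply by (simp add: b)
  then have "(T ^^ 1) ((T ^^ m) b) = (T ^^ 1) b" by simp
  then have "(T ^^ m) b = b" by (simp only: iet_funpow_inject)
  then show False using funpow_iet_D[OF b(1) assms] b by simp
qed

section \<open>Division points and the shortest gap\<close>

lemma division_points_iff:
  "x \<in> division_points d \<pi> len M \<longleftrightarrow>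
    x = 0 \<or> x = 1 \<or> x \<in> {0..<1} \<and> (\<exists>i\<le>M. (T ^^ i) x \<in> D)"
  by (auto simp: division_points_def)

lemma finite_division_points: "finite (division_points d \<pi> len M)"
proof -
  have "finite ((T ^^ i) -` D)" for i
    by (rule finite_vimageI) (auto simp: iet_D_def intro: bij_is_inj bij_iet_funpow)
  then show ?thesis unfolding division_points_def by blast
qed

lemma division_points_bounds: "x \<in> division_points d \<pi> len M \<Longrightarrow> 0 \<le> x \<and> x \<le> 1"
  by (auto simp: division_points_iff)

definition gaps :: "nat \<Rightarrow> real set" where
  "gaps M = {q - p | p q. p \<in> division_points d \<pi> len M \<and> q \<in> division_points d \<pi> len M \<and>
                       p < q \<and> {p<..<q} \<inter> division_points d \<pi> len M = {}}"

lemma finite_gaps: "finite (gaps M)"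
proof (rule finite_subset)
  show "gaps M \<subseteq> (\<lambda>(p, q). q - p) ` (division_points d \<pi> len M \<times> division_points d \<pi> len M)"
    by (auto simp: gaps_def)
qed (simp add: finite_division_points)

lemma gap_Min: "gap M = Min (gaps M)"
  by (simp add: min_length_def gaps_def)

text \<open>\<open>gap\<close> is a minimum over consecutive division points only; the witness is
  the distance from \<open>p\<close> to the next one.\<close>

lemma gaps_below:
  assumes "p \<in> division_points d \<pi> len M" "q \<in> division_points d \<pi> len M" "p < q"
  shows "\<exists>e\<in>gaps M. e \<le> q - p"
proof -
  let ?S = "{z \<in> division_points d \<pi> len M. p < z}"
  have fin: "finite ?S" using finite_division_points by simp
  have q: "q \<in> ?S" using assms by simp
  have min: "Min ?S \<in> ?S" using Min_in[OF fin] q by blast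
  have "{p<..<Min ?S} \<inter> division_points d \<pi> len M = {}"
    using Min_le[OF fin] by fastforce
  then have "Min ?S - p \<in> gaps M" using assms min by (auto simp: gaps_def)
  moreover have "Min ?S \<le> q" using Min_le[OF fin q] .
  ultimately show ?thesis by (intro bexI[of _ "Min ?S - p"]) auto
qed

lemma gap_le:
  assumes "p \<in> division_points d \<pi> len M" "q \<in> division_points d \<pi> len M" "p < q"
  shows "gap M \<le> q - p"
  using gaps_below[OF assms] Min_le[OF finite_gaps] unfolding gap_Min by force

lemma gap_pos: "gap M > 0"
proof -
  have "0 \<in> division_points d \<pi> len M" "1 \<in> division_points d \<pi> len M"
    by (simp_all add: division_points_iff)
  then have "gaps M \<noteq> {}" using gaps_below[of 0 M 1] by auto
  then have "gap M \<in> gaps M" unfolding gap_Min by (rule Min_in[OF finite_gaps])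
  then show ?thesis by (auto simp: gaps_def)
qed

lemma gap_isolates:
  assumes "p \<in> division_points d \<pi> len M" "q \<in> division_points d \<pi> len M" "\<bar>p - q\<bar> < gap M"
  shows "p = q"
  using gap_le[of p M q] gap_le[of q M p] assms by (cases p q rule: linorder_cases) auto

section \<open>Intervals that travel without being cut\<close>

text \<open>The exchanged intervals contain their left ends, so only the open interval has to avoid
  \<open>D\<close>, and \<open>x\<close> itself may lie in \<open>D\<close>.\<close>

lemma iet_translation:
  assumes "0 \<le> x" "x + s \<le> 1" "\<And>y. x < y \<Longrightarrow> y < x + s \<Longrightarrow> y \<notin> D" "0 \<le> t" "t < s"
  shows "T (x + t) = T x + t"
proof -
  have "x \<in> {0..<1}" using assms by auto
  then obtain i where i: "i \<in> {1..d}" "x \<in> iet_interval len i" by (rule iet_interval_exists)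
  have "\<not> endpoint len i < x + s"
  proof
    assume less: "endpoint len i < x + s"
    then have "i \<noteq> d" using assms by auto
    then have "endpoint len i \<in> D" using i by (auto simp: D_iff)
    then show False using assms(3)[of "endpoint len i"] less i by (auto simp: iet_interval_endpoint)
  qed
  then have "x + t \<in> iet_interval len i" using assms i by (auto simp: iet_interval_endpoint)
  then show ?thesis using iet_on_interval[OF i(1)] i(2) by simp
qed

lemma iet_funpow_translation:
  assumes x: "0 \<le> x" "x + s \<le> 1"
    and cont: "\<And>i y. i < k \<Longrightarrow> x < y \<Longrightarrow> y < x + s \<Longrightarrow> (T ^^ i) y \<notin> D"
    and "0 \<le> t" "t < s"
  shows "(T ^^ k) (x + t) = (T ^^ k) x + t"
  using cont \<open>0 \<le> t\<close> \<open>t < s\<close>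
proof (induction k arbitrary: t)
  case (Suc k)
  let ?y = "(T ^^ k) x"
  have IH: "(T ^^ k) (x + u) = ?y + u" if "0 \<le> u" "u < s" for u
    by (rule Suc.IH) (use that Suc.prems in auto)
  have in01: "x + u \<in> {0..<1}" if "0 \<le> u" "u < s" for u
    using x that by auto
  have y: "?y \<in> {0..<1}" using in01[of 0] Suc.prems by (simp add: iet_funpow_range_iff del: atLeastLessThan_iff)
  \<comment> \<open>Otherwise the point with parameter \<open>1 - ?y\<close> would be sent to 1,
    outside [0, 1).\<close>
  have "?y + s \<le> 1"
  proof (rule ccontr)
    assume "\<not> ?y + s \<le> 1"
    then have "0 \<le> 1 - ?y" "1 - ?y < s" using y by auto
    from IH[OF this] in01[OF this] iet_funpow_range_iff[of k "x + (1 - ?y)"]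
    show False by simp
  qed
  moreover have "z \<notin> D" if z: "?y < z" "z < ?y + s" for z
    using IH[of "z - ?y"] Suc.prems(1)[of k "x + (z - ?y)"] z by simp
  ultimately have "T (?y + t) = T ?y + t"
    using y Suc.prems by (intro iet_translation[where s = s]) auto
  then show ?case using IH Suc.prems by simp
qed simp

text \<open>The order \<open>M\<close> has to reach 2 m because the second division point found in
  the proof enters \<open>D\<close> at time i + m, where i < m. The bound is what keeps intervals
  along one orbit disjoint.\<close>

lemma return_distance:
  assumes x: "x \<in> {0..<1}" and m: "m \<ge> 1" "2 * m \<le> M"
  shows "gap M \<le> \<bar>(T ^^ m) x - x\<bar>"
proof (rule ccontr)
  define s where "s = (T ^^ m) x - x"
  assume "\<not> ?thesis"
  then have s_less: "\<bar>s\<bar> < gap M" by (simp add: s_def)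
  let ?P = "division_points d \<pi> len M"
  \<comment> \<open>Let \<open>[p, q)\<close> be the maximal interval around \<open>x\<close> on which \<open>T\<^sup>m\<close> is a translation, by \<open>s\<close>. The
    preimage under \<open>T\<^sup>m\<close> of its end in the direction of \<open>s\<close> is a further division point in \<open>[p, q)\<close>, at
    distance \<open>\<bar>s\<bar>\<close> from that end.\<close>
  define Q where "Q = {0, 1} \<union> {z \<in> {0..<1}. \<exists>i<m. (T ^^ i) z \<in> D}"
  have QP: "Q \<subseteq> ?P"
  proof
    fix z assume "z \<in> Q"
    then consider "z = 0" | "z = 1" | i where "z \<in> {0..<1}" "i < m" "(T ^^ i) z \<in> D"
      by (auto simp: Q_def)
    then show "z \<in> ?P"
    proof cases
      case 3
      then have "i \<le> M" using m by simp
      then show ?thesis using 3 unfolding division_points_iff by blast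
    qed (simp_all add: division_points_iff)
  qed
  then have fin: "finite Q" using finite_division_points by (rule finite_subset)
  define p where "p = Max {z \<in> Q. z \<le> x}"
  define q where "q = Min {z \<in> Q. x < z}"
  have "p \<in> {z \<in> Q. z \<le> x}" unfolding p_def by (rule Max_in) (use fin x in \<open>auto simp: Q_def\<close>)
  then have p: "p \<in> Q" "p \<le> x" by auto
  have "q \<in> {z \<in> Q. x < z}" unfolding q_def by (rule Min_in) (use fin x in \<open>auto simp: Q_def\<close>)
  then have q: "q \<in> Q" "x < q" by auto
  have between: "z \<notin> Q" if "p < z" "z < q" for z
  proof
    assume "z \<in> Q"
    then show False
      using that Max_ge[of "{z \<in> Q. z \<le> x}" z] Min_le[of "{z \<in> Q. x < z}" z] fin
      by (cases "z \<le> x") (simp_all flip: p_def q_def)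
  qed
  have pq: "gap M \<le> q - p" using gap_le p q QP by force
  have p0: "0 \<le> p" using p QP division_points_bounds by blast
  have q1: "q \<le> 1" using q QP division_points_bounds by blast
  have trans: "(T ^^ m) (p + t) = (T ^^ m) p + t" if "0 \<le> t" "t < q - p" for t
  proof (rule iet_funpow_translation[OF p0 _ _ that])
    show "p + (q - p) \<le> 1" using q1 by simp
    fix i y assume "i < m" "p < y" "y < p + (q - p)"
    then show "(T ^^ i) y \<notin> D" using between[of y] p0 q1 by (auto simp: Q_def)
  qed
  have "(T ^^ m) p = p + s" using trans[of "x - p"] p q by (simp add: s_def)
  then have move: "(T ^^ m) z = z + s" if "p \<le> z" "z < q" for z
    using trans[of "z - p"] that by simp
  have range: "0 \<le> z + s \<and> z + s < 1" if "p \<le> z" "z < q" for z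
    using iet_funpow_range_iff[of m z] move[OF that] that p0 q1 by auto
  consider "s > 0" | "s < 0" | "s = 0" by linarith
  then show False
  proof cases
    case 1
    \<comment> \<open>The right end 1 need not come from \<open>D\<close>; but then a translation to
      the right would carry points of [p, q) beyond 1.\<close>
    have "q \<noteq> 1"
    proof
      assume "q = 1"
      then show False using range[of "max p (1 - s)"] 1 q p by auto
    qed
    moreover have "q \<noteq> 0" using p0 p q by auto
    ultimately obtain i where i: "i < m" "(T ^^ i) q \<in> D" using q by (auto simp: Q_def)
    have qs: "p \<le> q - s" "q - s < q" using 1 s_less pq by auto
    have "(T ^^ (i + m)) (q - s) \<in> D" using move[OF qs] i by (simp add: funpow_add)
    then have "q - s \<in> ?P" using i m qs p0 q1 by (auto simp: division_points_iff intro!: exI[of _ "i + m"])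
    then have "gap M \<le> q - (q - s)" using q QP qs by (intro gap_le) auto
    then show False using s_less 1 by simp
  next
    case 2
    have "p \<noteq> 0" using range[of p] 2 p q by auto
    moreover have "p \<noteq> 1" using p x by auto
    ultimately obtain i where i: "i < m" "(T ^^ i) p \<in> D" using p by (auto simp: Q_def)
    have ps: "p \<le> p - s" "p - s < q" using 2 s_less pq by auto
    have "(T ^^ (i + m)) (p - s) \<in> D" using move[OF ps] i by (simp add: funpow_add)
    then have "p - s \<in> ?P" using i m ps p0 q1 by (auto simp: division_points_iff intro!: exI[of _ "i + m"])
    then have "gap M \<le> (p - s) - p" using p QP 2 by (intro gap_le) auto
    then show False using s_less 2 by simp
  next
    \<comment> \<open>Zero displacement makes \<open>p\<close> periodic, while \<open>p\<close> is 0
      or enters \<open>D\<close>, and either excludes periodicity.\<close>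
    case 3
    then have per: "(T ^^ m) p = p" using move[of p] p q by simp
    then have "p \<noteq> 0" using zero_aperiodic m by auto
    moreover have "p \<noteq> 1" using p x by auto
    ultimately obtain i where i: "i < m" "(T ^^ i) p \<in> D" using p by (auto simp: Q_def)
    have "(T ^^ (i + m)) p \<in> D" using i by (simp add: funpow_add per)
    then show False using hits_D_once[OF i(2), of "i + m"] m by simp
  qed
qed

lemma orbit_separated:
  assumes x: "x \<in> {0..<1}" and "i \<noteq> j" "2 * i \<le> M" "2 * j \<le> M"
  shows "gap M \<le> \<bar>(T ^^ i) x - (T ^^ j) x\<bar>"
proof -
  have aux: "gap M \<le> \<bar>(T ^^ b) x - (T ^^ a) x\<bar>" if "a < b" "2 * b \<le> M" for a b
  proof -
    have "(T ^^ b) x = (T ^^ (b - a)) ((T ^^ a) x)"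
      using that by (simp flip: funpow_add[THEN fun_cong, unfolded comp_apply])
    then show ?thesis
      using return_distance[of "(T ^^ a) x" "b - a" M] that x iet_funpow_range_iff[of a x] by auto
  qed
  show ?thesis
    using aux[of i j] aux[of j i] assms by (cases "i < j") (auto simp: abs_minus_commute)
qed

text \<open>A point within \<open>gap M\<close> of \<open>b\<close> that enters \<open>D\<close>
  before time \<open>m\<close> would be a division point, hence \<open>b\<close> itself; but
  \<open>b\<close> enters \<open>D\<close> at time m + i and at no other. So the translation is
  two-sided. As 0 and 1 are division points, the neighbourhood stays inside the unit
  interval.\<close>

lemma backward_translation:
  assumes b: "b \<in> {0..<1}" and hit: "(T ^^ (m + i)) b \<in> D" and M: "m + i \<le> M"
  shows "gap M \<le> b" and "b + gap M \<le> 1"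
    and "- gap M \<le> t \<Longrightarrow> t < gap M \<Longrightarrow> (T ^^ m) (b + t) = (T ^^ m) b + t"
proof -
  let ?P = "division_points d \<pi> len M"
  have P: "b \<in> ?P" using b hit M by (auto simp: division_points_iff)
  have P01: "0 \<in> ?P" "1 \<in> ?P" by (simp_all add: division_points_iff)
  have "b \<noteq> 0" using hit zero_never_hits_D by auto
  then show lo: "gap M \<le> b" using gap_le[OF P01(1) P] b by auto
  show hi: "b + gap M \<le> 1" using gap_le[OF P P01(2)] b by auto
  have trans: "(T ^^ m) (b - gap M + t) = (T ^^ m) (b - gap M) + t" if "0 \<le> t" "t < 2 * gap M" for t
  proof (rule iet_funpow_translation[OF _ _ _ that])
    show "0 \<le> b - gap M" "b - gap M + 2 * gap M \<le> 1" using lo hi by auto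
    fix l y assume l: "l < m" and y: "b - gap M < y" "y < b - gap M + 2 * gap M"
    show "(T ^^ l) y \<notin> D"
    proof
      assume D: "(T ^^ l) y \<in> D"
      then have "y \<in> ?P" using y lo hi l M by (auto simp: division_points_iff intro!: exI[of _ l])
      then have "y = b" using gap_isolates[OF _ P] y by auto
      then show False using hits_D_once[OF D] hit l by auto
    qed
  qed
  assume "- gap M \<le> t" "t < gap M"
  then show "(T ^^ m) (b + t) = (T ^^ m) b + t"
    using trans[of "gap M"] trans[of "gap M + t"] gap_pos[of M] by simp
qed

text \<open>Here \<open>b\<close> may itself be a discontinuity, so only its right side is
  controlled. It is a division point, so no other lies within \<open>gap M\<close> of it.\<close>

lemma forward_translation:
  assumes "b \<in> D \<or> b = 0" "k \<le> M"
  shows "b + gap M \<le> 1"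
    and "0 \<le> t \<Longrightarrow> t < gap M \<Longrightarrow> (T ^^ k) (b + t) = (T ^^ k) b + t"
proof -
  let ?P = "division_points d \<pi> len M"
  have b: "b \<in> {0..<1}" using assms D_bounds by force
  have P: "b \<in> ?P" using assms b by (auto simp: division_points_iff intro!: exI[of _ 0])
  have P1: "1 \<in> ?P" by (simp add: division_points_iff)
  show hi: "b + gap M \<le> 1" using gap_le[OF P P1] b by auto
  assume t: "0 \<le> t" "t < gap M"
  show "(T ^^ k) (b + t) = (T ^^ k) b + t"
  proof (rule iet_funpow_translation[OF _ hi _ t])
    show "0 \<le> b" using b by simp
    fix i y assume i: "i < k" and y: "b < y" "y < b + gap M"
    show "(T ^^ i) y \<notin> D"
    proof
      assume "(T ^^ i) y \<in> D"
      then have "y \<in> ?P" using y b hi i assms by (auto simp: division_points_iff intro!: exI[of _ i])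
      then show False using gap_isolates[OF _ P] y by force
    qed
  qed
qed

lemma endpoint_division_point: "j \<le> d \<Longrightarrow> endpoint len j \<in> division_points d \<pi> len M"
  using endpoint_nonneg[of j] endpoint_less_1[of j] endpoint_in_D[of j]
  by (cases "j = 0 \<or> j = d") (auto simp: division_points_iff intro!: exI[of _ 0])

lemma endpoint_gap: "j \<in> {1..d} \<Longrightarrow> gap M \<le> len j"
  using gap_le[OF endpoint_division_point endpoint_division_point, of "j - 1" j M]
    endpoint_strict_mono[of "j - 1" j] endpoint_pred[of j len]
  by auto

text \<open>To the left of an endpoint \<open>j\<close> the transformation behaves as to the left of the point
  into which it maps the endpoint \<open>\<sigma> j\<close>: this is the meaning of \<open>\<sigma>\<close>.\<close>

lemma left_translation:
  assumes j: "j \<in> {1..<d}" "\<pi> j \<noteq> d" and k: "1 \<le> k" "k \<le> M" and t: "0 < t" "t \<le> gap M"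
  shows "(T ^^ k) (endpoint len j - t) = (T ^^ k) (endpoint len (sigma_perm d \<pi> j)) - t"
proof -
  let ?P = "division_points d \<pi> len M"
  define b where "b = endpoint len j"
  define b' where "b' = endpoint len (sigma_perm d \<pi> j)"
  define y where "y = T b'"
  have jd: "j \<in> {1..d}" using j by auto
  have y_eq: "y = endpoint (len \<circ> inv \<pi>) (\<pi> j)" using iet_sigma(2)[OF jd j(2)] by (simp add: y_def b'_def)
  have b'D: "b' \<in> D \<or> b' = 0"
    using iet_sigma(1)[OF jd j(2)] by (cases "sigma_perm d \<pi> j = 0") (auto simp: b'_def intro: endpoint_in_D)
  have b'01: "b' \<in> {0..<1}" using b'D D_bounds by force
  have bP: "b \<in> ?P" using endpoint_division_point[of j] j by (simp add: b_def)
  have b'P: "b' \<in> ?P" using endpoint_division_point iet_sigma(1)[OF jd j(2)] by (simp add: b'_def)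
  have bD: "b \<in> D" using j by (auto simp: b_def D_iff)
  have b_low: "b - gap M \<ge> 0"
  proof -
    have "0 \<le> endpoint len (j - 1)" using j by (intro endpoint_nonneg) auto
    then show ?thesis
      using endpoint_gap[OF jd, of M] endpoint_pred[of j len] j by (simp add: b_def)
  qed
  \<comment> \<open>The left side of \<open>b\<close> and the right side of \<open>b'\<close> are
    mapped to the two sides of the same point \<open>y\<close>.\<close>
  have left: "T (b - u) = y - u" if "0 < u" "u \<le> gap M" for u
  proof -
    have "b - u \<in> iet_interval len j"
      using endpoint_gap[OF jd, of M] endpoint_pred[of j len] j that
      by (simp add: b_def iet_interval_endpoint)
    moreover have "endpoint (len \<circ> inv \<pi>) (\<pi> j) = endpoint (len \<circ> inv \<pi>) (\<pi> j - 1) + len j"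
      using endpoint_pred[of "\<pi> j" "len \<circ> inv \<pi>"] perm_in[OF jd] permutes_inverses[OF perm] by auto
    ultimately show ?thesis
      using iet_on_interval[OF jd] endpoint_pred[of j len] j
      by (simp add: y_eq b_def shift_def)
  qed
  have right: "T (b' + u) = y + u" if "0 \<le> u" "u < gap M" for u
    using forward_translation(2)[of b' 1 M u] b'D k that by (simp add: y_def)
  have right01: "b' + u \<in> {0..<1}" if "0 \<le> u" "u < gap M" for u
    using forward_translation(1)[of b' 1 M] b'D b'01 k that by auto
  have "b - gap M \<in> {0..<1}" using b_low D_bounds[OF bD] gap_pos[of M] by auto
  then have y_low: "0 \<le> y - gap M" using left[of "gap M"] gap_pos[of M] iet_range[of "b - gap M"] by auto
  have y1: "y < 1" using iet_range[of b'] b'01 by (simp add: y_def)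
  have y_high: "y + gap M \<le> 1"
  proof (rule ccontr)
    assume "\<not> ?thesis"
    then have "0 \<le> 1 - y" "1 - y < gap M" using y1 by auto
    from right[OF this] right01[OF this] iet_range[of "b' + (1 - y)"] show False by simp
  qed
  have trans: "(T ^^ (k - 1)) (y - gap M + u) = (T ^^ (k - 1)) (y - gap M) + u"
    if "0 \<le> u" "u < 2 * gap M" for u
  proof (rule iet_funpow_translation[OF _ _ _ that])
    show "0 \<le> y - gap M" "y - gap M + 2 * gap M \<le> 1" using y_low y_high by auto
    fix i z assume i: "i < k - 1" and z: "y - gap M < z" "z < y - gap M + 2 * gap M"
    \<comment> \<open>Every \<open>z\<close> near \<open>y\<close> is the image of some
      \<open>w\<close> that is \<open>b'\<close> or no division point. A visit of \<open>z\<close>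
      to \<open>D\<close> at time \<open>i\<close> is one of \<open>w\<close> at time i + 1, too
      early for a point that is no division point, and impossible for \<open>b'\<close>, which is 0
      or lies in \<open>D\<close>.\<close>
    have "(T ^^ i) z \<notin> D" if "w \<in> {0..<1}" "z = T w" "w = b' \<or> w \<notin> ?P" for w
    proof
      assume "(T ^^ i) z \<in> D"
      then have "(T ^^ Suc i) w \<in> D" unfolding funpow_Suc_right by (simp add: that)
      then show False
      proof (cases "w = b'")
        case True
        then show False
          using b'D \<open>(T ^^ Suc i) w \<in> D\<close> zero_never_hits_D[of "Suc i"] funpow_iet_D[of b' "Suc i"]
          by (auto simp del: funpow.simps)
      next
        case False
        then show False using that \<open>(T ^^ Suc i) w \<in> D\<close> i k unfolding division_points_iff
          by (auto simp del: funpow.simps dest!: spec[of _ "Suc i"])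
      qed
    qed note * = this
    show "(T ^^ i) z \<notin> D"
    proof (cases "z < y")
      case True
      let ?w = "b - (y - z)"
      have "?w \<notin> ?P" using gap_isolates[OF _ bP, of ?w] True z by auto
      moreover have "?w \<in> {0..<1}" using b_low D_bounds[OF bD] True z by auto
      ultimately show ?thesis using *[of ?w] left[of "y - z"] True z by auto
    next
      case False
      let ?w = "b' + (z - y)"
      have "?w = b' \<or> ?w \<notin> ?P" using gap_isolates[OF _ b'P, of ?w] False z by auto
      then show ?thesis using *[of ?w] right[of "z - y"] right01[of "z - y"] False z by auto
    qed
  qed
  have "(T ^^ (k - 1)) (y - t) = (T ^^ (k - 1)) y - t"
    using trans[of "gap M"] trans[of "gap M - t"] t by simp
  then have "(T ^^ (k - 1)) (T (b - t)) = (T ^^ (k - 1)) (T b') - t"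
    using left[OF t] by (simp add: y_def)
  then have "(T ^^ Suc (k - 1)) (b - t) = (T ^^ Suc (k - 1)) b' - t"
    unfolding funpow_Suc_right comp_apply .
  then show ?thesis using k by (simp add: b_def b'_def)
qed

end

section \<open>Ergodicity\<close>

lemma nat_predicate_jump:
  assumes "P a" "\<not> P b" "a < (N::nat)" "b < N"
  shows "\<exists>i. Suc i < N \<and> P i \<noteq> P (Suc i)"
proof (rule ccontr)
  assume "\<not> ?thesis"
  then have step: "P i = P (Suc i)" if "Suc i < N" for i using that by blast
  have "P i = P 0" if "i < N" for i
    using that by (induction i) (use step in auto)
  then show False using assms by blast
qed

locale linearly_recurrent_interval_exchange = idoc_interval_exchange +
  fixes c :: real
  assumes c_pos: "c > 0"
    and c_le_gap: "\<And>n. n \<ge> 1 \<Longrightarrow> c \<le> real n * gap n"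
begin

lemma gap_le_1: "gap M \<le> 1"
  using gap_le[of 0 M 1] by (simp add: division_points_iff)

lemma c_le_1: "c \<le> 1"
  using c_le_gap[of 1] gap_le_1[of 1] by simp

text \<open>If the interval does not meet the preimages of \<open>D\<close>, follow it forward, otherwise follow it
  backward.\<close>

lemma translates_exist:
  assumes x: "0 \<le> x" "x + w \<le> 1" and w: "0 < w" "w \<le> gap (2 * n)"
  obtains a :: "nat \<Rightarrow> real" where
    "\<And>i t. i < n \<Longrightarrow> 0 \<le> t \<Longrightarrow> t < w \<Longrightarrow> a i + t \<in> {0..<1}"
    "\<And>i j. i < n \<Longrightarrow> j < n \<Longrightarrow> i \<noteq> j \<Longrightarrow> w \<le> \<bar>a i - a j\<bar>"
    "\<And>B i t. \<lbrakk>\<And>z. T z \<in> B \<longleftrightarrow> z \<in> B; i < n; 0 \<le> t; t < w\<rbrakk> \<Longrightarrow> a i + t \<in> B \<longleftrightarrow> x + t \<in> B"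
proof -
  have invariant: "(T ^^ i) z \<in> B \<longleftrightarrow> z \<in> B" if "\<And>z. T z \<in> B \<longleftrightarrow> z \<in> B" for B i z
    by (induction i) (use that in auto)
  show ?thesis
  proof (cases "\<exists>i<n. \<exists>y. x < y \<and> y < x + w \<and> (T ^^ i) y \<in> D")
    case False
    have move: "(T ^^ i) (x + t) = (T ^^ i) x + t" if "i < n" "0 \<le> t" "t < w" for i t
      by (rule iet_funpow_translation[OF x _ that(2,3)]) (use False that in \<open>meson less_trans\<close>)
    have x01: "x + t \<in> {0..<1}" if "0 \<le> t" "t < w" for t using x that by auto
    show ?thesis
    proof (rule that[of "\<lambda>i. (T ^^ i) x"])
      show "(T ^^ i) x + t \<in> {0..<1}" if "i < n" "0 \<le> t" "t < w" for i t
        using iet_funpow_range_iff[of i "x + t"] x01[of t] move[of i t] that by simp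
      show "w \<le> \<bar>(T ^^ i) x - (T ^^ j) x\<bar>" if "i < n" "j < n" "i \<noteq> j" for i j
        using orbit_separated[of x i j "2 * n"] that w x01[of 0] by auto
      show "(T ^^ i) x + t \<in> B \<longleftrightarrow> x + t \<in> B"
        if "\<And>z. T z \<in> B \<longleftrightarrow> z \<in> B" "i < n" "0 \<le> t" "t < w" for B i t
        using invariant[OF that(1), of i "x + t"] move[OF that(2-4)] by simp
    qed
  next
    case True
    then obtain k y where k: "k < n" and y: "x < y" "y < x + w" and hit: "(T ^^ k) y \<in> D" by auto
    \<comment> \<open>\<open>y\<close> enters \<open>D\<close> at time k < n, so for m < n its
      preimage \<open>b m\<close> enters \<open>D\<close> at time m + k < 2 n, and
      \<open>backward_translation\<close> applies at order 2 n.\<close>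
    define b where "b m = inv (T ^^ m) y" for m
    have Tb: "(T ^^ m) (b m) = y" for m
      unfolding b_def by (rule surj_f_inv_f[OF bij_is_surj[OF bij_iet_funpow]])
    have b01: "b m \<in> {0..<1}" for m
      using iet_funpow_range_iff[of m "b m"] Tb[of m] x y by auto
    have hitb: "(T ^^ (m + k)) (b m) \<in> D" for m
      using hit Tb[of m] by (simp add: funpow_add add.commute[of m])
    note bwd = backward_translation[OF b01 hitb, where M = "2 * n"]
    have b_diff: "gap (2 * n) \<le> \<bar>b i - b j\<bar>" if "i < j" "j < n" for i j
    proof -
      have "(T ^^ i) ((T ^^ (j - i)) (b j)) = (T ^^ j) (b j)"
        using that by (simp flip: funpow_add[THEN fun_cong, unfolded comp_apply])
      also have "\<dots> = (T ^^ i) (b i)" by (simp add: Tb)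
      finally have "(T ^^ (j - i)) (b j) = b i" by simp
      then show ?thesis using orbit_separated[of "b j" "j - i" 0 "2 * n"] b01 that by auto
    qed
    \<comment> \<open>\<open>y\<close> lies at offset y - x in the given interval, so the preimages
      of the interval begin at this offset to the left of those of \<open>y\<close>.\<close>
    let ?a = "\<lambda>i. b i - (y - x)"
    show ?thesis
    proof (rule that[of ?a])
      show "?a i + t \<in> {0..<1}" if "i < n" "0 \<le> t" "t < w" for i t
        using bwd(1,2)[of i] that k y w by auto
      show "w \<le> \<bar>?a i - ?a j\<bar>" if "i < n" "j < n" "i \<noteq> j" for i j
        using b_diff[of i j] b_diff[of j i] that w by (cases "i < j") (auto simp: abs_minus_commute)
      show "?a i + t \<in> B \<longleftrightarrow> x + t \<in> B"
        if "\<And>z. T z \<in> B \<longleftrightarrow> z \<in> B" "i < n" "0 \<le> t" "t < w" for B i t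
      proof -
        have "(T ^^ i) (b i + (t - (y - x))) = (T ^^ i) (b i) + (t - (y - x))"
          by (rule bwd(3)) (use that k y w in auto)
        also have "\<dots> = x + t" by (simp add: Tb)
        finally show ?thesis using invariant[OF that(1), of i "?a i + t"] by (simp add: algebra_simps)
      qed
    qed
  qed
qed

text \<open>All \<open>n\<close> disjoint translates carry the same pattern of \<open>B\<close>.
  Each is shorter than \<rho>, so off \<open>R\<close> it cannot meet both \<open>B\<close> and the
  complement; hence \<open>R\<close> covers one of the two there, and with it at least measure
  \<open>v\<close>.\<close>

lemma invariant_set_density:
  assumes B: "B \<in> sets lebesgue" "B \<subseteq> {0..<1}" and inv: "\<And>z. T z \<in> B \<longleftrightarrow> z \<in> B"
    and R: "R \<in> lmeasurable"
    and const: "\<And>x y. x \<in> {0..<1} - R \<Longrightarrow> y \<in> {0..<1} - R \<Longrightarrow> dist x y < \<rho> \<Longrightarrow> x \<in> B \<longleftrightarrow> y \<in> B"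
    and x: "0 \<le> x" "x + w \<le> 1" and w: "0 < w" "w \<le> gap (2 * n)" "w < \<rho>"
    and v: "v \<le> measure lebesgue (B \<inter> {x..<x + w})" "v \<le> measure lebesgue ({x..<x + w} - B)"
  shows "real n * v \<le> measure lebesgue R"
proof -
  obtain a where a: "\<And>i t. i < n \<Longrightarrow> 0 \<le> t \<Longrightarrow> t < w \<Longrightarrow> a i + t \<in> {0..<1}"
    "\<And>i j. i < n \<Longrightarrow> j < n \<Longrightarrow> i \<noteq> j \<Longrightarrow> w \<le> \<bar>a i - a j\<bar>"
    "\<And>B i t. \<lbrakk>\<And>z. T z \<in> B \<longleftrightarrow> z \<in> B; i < n; 0 \<le> t; t < w\<rbrakk> \<Longrightarrow> a i + t \<in> B \<longleftrightarrow> x + t \<in> B"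
    by (rule translates_exist[OF x w(1,2)]) blast
  have meas: "R \<in> sets lebesgue" using R by (rule fmeasurableD)
  have nB: "- B \<in> sets lebesgue" using B(1) sets.compl_sets[of B lebesgue] by (simp add: Compl_eq_Diff_UNIV)
  have "v \<le> measure lebesgue (window (a i) w R)" if i: "i < n" for i
  proof (rule ccontr)
    assume less: "\<not> ?thesis"
    have "\<not> window x w B \<subseteq> window (a i) w R"
    proof
      assume "window x w B \<subseteq> window (a i) w R"
      then have "measure lebesgue (window x w B) \<le> measure lebesgue (window (a i) w R)"
        by (rule measure_mono_fmeasurable)
          (use lmeasurable_window[OF B(1)] lmeasurable_window[OF meas] in auto)
      then show False using v(1) less by (simp add: measure_window)
    qed
    then obtain t where t: "t \<in> window x w B" "t \<notin> window (a i) w R" by auto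
    have "\<not> window x w (- B) \<subseteq> window (a i) w R"
    proof
      assume "window x w (- B) \<subseteq> window (a i) w R"
      then have "measure lebesgue (window x w (- B)) \<le> measure lebesgue (window (a i) w R)"
        by (rule measure_mono_fmeasurable)
          (use lmeasurable_window[OF nB] lmeasurable_window[OF meas] in auto)
      moreover have "{x..<x + w} - B = - B \<inter> {x..<x + w}" by auto
      ultimately show False using v(2) less by (simp add: measure_window)
    qed
    then obtain u where u: "u \<in> window x w (- B)" "u \<notin> window (a i) w R" by auto
    have "a i + t \<in> B" "a i + u \<notin> B" "a i + t \<in> {0..<1} - R" "a i + u \<in> {0..<1} - R"
      using t u a(1)[OF i] a(3)[OF inv i] by (auto simp: window_iff)
    moreover have "dist (a i + t) (a i + u) < \<rho>"
      using t u w by (auto simp: window_iff dist_real_def)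
    ultimately show False using const by blast
  qed
  then have "real n * v \<le> (\<Sum>i<n. measure lebesgue (window (a i) w R))"
    using sum_bounded_below[of "{..<n}" v "\<lambda>i. measure lebesgue (window (a i) w R)"] by simp
  also have "\<dots> \<le> measure lebesgue R"
    by (rule sum_measure_window_le) (use R a in auto)
  finally show ?thesis .
qed

text \<open>Cut [0, 1) into \<open>N\<close> short intervals, each coloured by whether
  \<open>B\<close> fills at least half of it. The colour turns out to be constant, so in every
  interval the minority part is bounded by the part of \<open>R\<close>, and \<open>B\<close> or its
  complement has measure less than \<eta>.\<close>

theorem ergodic:
  assumes B: "B \<in> sets lebesgue" "B \<subseteq> {0..<1}" and inv: "\<And>z. T z \<in> B \<longleftrightarrow> z \<in> B"
  shows "measure lebesgue B = 0 \<or> measure lebesgue B = 1"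
proof (rule ccontr)
  assume nontrivial: "\<not> ?thesis"
  have compl: "measure lebesgue ({0..<1} - B) = 1 - measure lebesgue B"
    using measurable_measure_Diff[of "{0..<1}" lebesgue B] B by simp
  have "measure lebesgue B \<le> measure lebesgue {0..<1::real}"
    by (rule measure_mono_fmeasurable) (use B in auto)
  then have B01: "0 < measure lebesgue B" "measure lebesgue B < 1"
    using nontrivial measure_nonneg[of lebesgue B] by (auto simp: less_le simp del: measure_nonneg)
  \<comment> \<open>The bound c / 16 refutes a change of colour, by \<open>ns\<close>; the other two
    refute the two constant colourings.\<close>
  define \<eta> where "\<eta> = min (c / 16) (min (measure lebesgue B) (1 - measure lebesgue B))"
  have "\<eta> > 0" using c_pos B01 by (simp add: \<eta>_def)
  have I01': "{0..<1::real} \<in> sets lebesgue" "bounded {0..<1::real}" by auto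
  obtain R \<rho> where R: "R \<in> lmeasurable" "measure lebesgue R < \<eta>" and \<rho>: "\<rho> > 0"
    and const: "\<And>x y. x \<in> {0..<1} - R \<Longrightarrow> y \<in> {0..<1} - R \<Longrightarrow> dist x y < \<rho> \<Longrightarrow> x \<in> B \<longleftrightarrow> y \<in> B"
    by (rule almost_locally_constant[OF B I01' \<open>\<eta> > 0\<close>], rule that)
  obtain n :: nat where n: "real n > max 1 (c / \<rho>)" using reals_Archimedean2 by blast
  \<comment> \<open>Two neighbouring intervals have length 2 s, at most c / (2 n) and thus at most
    \<open>gap (2 * n)\<close>, while s stays at least c / (8 n). That n exceeds c / \<rho> makes 2
    s smaller than \<rho>.\<close>
  define N where "N = nat \<lceil>4 * real n / c\<rceil>"
  define s where "s = 1 / real N"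
  have N: "4 * real n / c \<le> real N" "real N \<le> 4 * real n / c + 1"
    using n c_pos by (auto simp: N_def)
  have "N \<ge> 1" using N(1) n c_pos by (cases N) (auto simp: field_simps)
  then have s: "s > 0" by (simp add: s_def)
  have s_le: "s \<le> c / (4 * real n)"
    using N(1) n c_pos \<open>N \<ge> 1\<close> by (simp add: s_def field_simps)
  have gap: "2 * s \<le> gap (2 * n)"
  proof -
    have "s * (4 * real n) \<le> c" using s_le n by (simp add: field_simps)
    also have "c \<le> real (2 * n) * gap (2 * n)" using n by (intro c_le_gap) auto
    finally have "real (2 * n) * (2 * s) \<le> real (2 * n) * gap (2 * n)" by (simp add: mult_ac)
    then show ?thesis using n by (subst (asm) mult_le_cancel_left_pos) auto
  qed
  have s\<rho>: "2 * s < \<rho>"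
  proof -
    have "c < real n * \<rho>" using n \<rho> by (simp add: field_simps)
    moreover have "2 * s * real n \<le> c / 2" using s_le n by (simp add: field_simps)
    ultimately have "2 * s * real n < \<rho> * real n" using c_pos by (simp add: mult_ac)
    then show ?thesis using n by simp
  qed
  have ns: "c / 16 \<le> real n * (s / 2)"
  proof -
    have "real N \<le> 8 * real n / c" using N(2) n c_le_1 c_pos by (simp add: field_simps)
    then show ?thesis using \<open>N \<ge> 1\<close> c_pos by (simp add: s_def field_simps)
  qed
  let ?I = "\<lambda>i. {real i / real N..<real i / real N + 1 / real N}"
  have I_eq: "?I i = {real i * s..<real i * s + s}" for i by (simp add: s_def)
  have mI: "measure lebesgue (?I i) = s" for i using s by (simp add: s_def)
  have lI: "B \<inter> ?I i \<in> lmeasurable" "?I i - B \<in> lmeasurable" "R \<inter> ?I i \<in> lmeasurable" for i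
    using B(1) fmeasurableD[OF R(1)]
    by (auto intro!: lmeasurable_subset_interval[where a = "real i / real N"
          and b = "real i / real N + 1 / real N"])
  have split: "measure lebesgue (B \<inter> ?I i) + measure lebesgue (?I i - B) = s" for i
  proof -
    have "B \<inter> ?I i \<union> (?I i - B) = ?I i" "(B \<inter> ?I i) \<inter> (?I i - B) = {}" by auto
    then show ?thesis
      using measure_Un3[OF lI(1) lI(2), of i i] mI[of i] by (simp only: measure_empty)
  qed
  have I01: "?I i \<subseteq> {0..<1}" if "i < N" for i
  proof -
    have "real i + 1 \<le> real N" using that by simp
    then have "real i / real N + 1 / real N \<le> 1" using \<open>N \<ge> 1\<close> by (simp add: field_simps)
    then show ?thesis by auto
  qed
  \<comment> \<open>If both colours occur, then two adjacent intervals of different colour form an interval that \<open>B\<close>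
    splits evenly up to a constant, and by invariance so do all its translates, which is impossible
    outside \<open>R\<close>.\<close>
  define blue where "blue i \<longleftrightarrow> s / 2 \<le> measure lebesgue (B \<inter> ?I i)" for i :: nat
  have no_jump: "blue i = blue (Suc i)" if i: "Suc i < N" for i
  proof (rule ccontr)
    let ?J = "{real i * s..<real i * s + 2 * s}"
    have J: "?I i \<subseteq> ?J" "?I (Suc i) \<subseteq> ?J" using s unfolding I_eq by (auto simp: algebra_simps)
    have mono: "measure lebesgue (B \<inter> ?I k) \<le> measure lebesgue (B \<inter> ?J)"
      "measure lebesgue (?I k - B) \<le> measure lebesgue (?J - B)" if "?I k \<subseteq> ?J" for k
      using that lI(1,2)[of k] B(1)
      by (intro measure_mono_fmeasurable;
          auto intro!: lmeasurable_subset_interval[where a = "real i * s" and b = "real i * s + 2 * s"])+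
    assume "blue i \<noteq> blue (Suc i)"
    then have "s / 2 \<le> measure lebesgue (B \<inter> ?J)" "s / 2 \<le> measure lebesgue (?J - B)"
      using mono[OF J(1)] mono[OF J(2)] split[of i] split[of "Suc i"] unfolding blue_def by linarith+
    moreover have "real i * s + 2 * s \<le> 1"
    proof -
      have "(real i + 2) * s \<le> real N * s" using i s by (intro mult_right_mono) auto
      then show ?thesis using \<open>N \<ge> 1\<close> by (simp add: s_def algebra_simps)
    qed
    ultimately have "real n * (s / 2) \<le> measure lebesgue R"
      using s gap s\<rho>
      by (intro invariant_set_density[OF B inv R(1) const, where x = "real i * s" and w = "2 * s"]) auto
    then show False using ns R(2) by (simp add: \<eta>_def)
  qed
  \<comment> \<open>Each interval is shorter than \<rho>, so off \<open>R\<close> it lies entirely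
    inside or entirely outside \<open>B\<close>.\<close>
  have minority: "v \<le> measure lebesgue (R \<inter> ?I i)"
    if "i < N" "v \<le> measure lebesgue (B \<inter> ?I i)" "v \<le> measure lebesgue (?I i - B)" for i v
  proof -
    have "B \<inter> ?I i \<subseteq> R \<inter> ?I i \<or> ?I i - B \<subseteq> R \<inter> ?I i"
    proof (rule ccontr)
      assume "\<not> ?thesis"
      then obtain y z where yz: "y \<in> ?I i" "y \<in> B" "y \<notin> R" "z \<in> ?I i" "z \<notin> B" "z \<notin> R" by blast
      then have "dist y z < \<rho>" using s s\<rho> unfolding I_eq by (auto simp: dist_real_def)
      then show False using const[of y z] yz I01[OF that(1)] by blast
    qed
    then show ?thesis
      using that(2,3) measure_mono_fmeasurable[OF _ fmeasurableD[OF lI(1)] lI(3), of i i]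
        measure_mono_fmeasurable[OF _ fmeasurableD[OF lI(2)] lI(3), of i i]
      by linarith
  qed
  have R_split: "(\<Sum>i<N. measure lebesgue (R \<inter> ?I i)) \<le> measure lebesgue R"
  proof -
    have "(\<Sum>i<N. measure lebesgue (R \<inter> ?I i)) = (\<Sum>i<N. measure lebesgue (R \<inter> {0..<1} \<inter> ?I i))"
    proof (rule sum.cong[OF refl])
      fix i assume "i \<in> {..<N}"
      then have "R \<inter> ?I i = R \<inter> {0..<1} \<inter> ?I i" using I01[of i] by blast
      then show "measure lebesgue (R \<inter> ?I i) = measure lebesgue (R \<inter> {0..<1} \<inter> ?I i)" by simp
    qed
    also have "\<dots> = measure lebesgue (R \<inter> {0..<1})"
      by (rule measure_split_intervals[symmetric]) (use R \<open>N \<ge> 1\<close> in auto)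
    also have "\<dots> \<le> measure lebesgue R"
      using R by (intro measure_mono_fmeasurable) auto
    finally show ?thesis .
  qed
  consider "\<And>i. i < N \<Longrightarrow> blue i" | "\<And>i. i < N \<Longrightarrow> \<not> blue i"
    using nat_predicate_jump[where P = blue and N = N] no_jump by blast
  then show False
  proof cases
    case 1
    have "1 - measure lebesgue B = (\<Sum>i<N. measure lebesgue (({0..<1} - B) \<inter> ?I i))"
      using measure_split_intervals[OF sets.Diff[OF I01'(1) B(1)] _ \<open>N \<ge> 1\<close>] compl by auto
    also have "\<dots> \<le> (\<Sum>i<N. measure lebesgue (R \<inter> ?I i))"
    proof (rule sum_mono)
      fix i assume "i \<in> {..<N}"
      then have i: "i < N" by simp
      have eq: "({0..<1} - B) \<inter> ?I i = ?I i - B" using I01[OF i] by blast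
      show "measure lebesgue (({0..<1} - B) \<inter> ?I i) \<le> measure lebesgue (R \<inter> ?I i)"
        unfolding eq by (rule minority[OF i]) (use 1[OF i] split[of i] in \<open>auto simp: blue_def\<close>)
    qed
    finally show False using R_split R(2) by (simp add: \<eta>_def)
  next
    case 2
    have "measure lebesgue B = (\<Sum>i<N. measure lebesgue (B \<inter> ?I i))"
      by (rule measure_split_intervals[OF B \<open>N \<ge> 1\<close>])
    also have "\<dots> \<le> (\<Sum>i<N. measure lebesgue (R \<inter> ?I i))"
    proof (rule sum_mono)
      fix i assume "i \<in> {..<N}"
      then have i: "i < N" by simp
      show "measure lebesgue (B \<inter> ?I i) \<le> measure lebesgue (R \<inter> ?I i)"
        by (rule minority[OF i]) (use 2[OF i] split[of i] in \<open>auto simp: blue_def\<close>)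
    qed
    finally show False using R_split R(2) by (simp add: \<eta>_def)
  qed
qed

end

section \<open>The cycles of \<open>\<sigma>\<close> and almost invariant sets\<close>

context interval_exchange
begin

section \<open>The permutation \<sigma> and its cycle through 0\<close>

lemma sigma_top: "j \<in> {1..d} \<Longrightarrow> \<pi> j = d \<Longrightarrow> sigma_perm d \<pi> j = d"
  by (auto simp: sigma_perm_def)

text \<open>This describes \<sigma> without \<open>inv\<close> and subtraction, in a form from which
  \<open>j\<close> can be recovered.\<close>

lemma sigma_next:
  assumes "d \<ge> 1" "j \<le> d" "j = 0 \<or> \<pi> j \<noteq> d"
  shows "sigma_perm d \<pi> j < d \<and> \<pi> (Suc (sigma_perm d \<pi> j)) = (if j = 0 then 1 else Suc (\<pi> j))"
proof -
  define q where "q = (if j = 0 then 1 else Suc (\<pi> j))"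
  have "q \<in> {1..d}"
    using assms perm_in[of j] by (auto simp: q_def)
  then have "inv \<pi> q \<in> {1..d}" "\<pi> (inv \<pi> q) = q"
    using permutes_in_image[OF permutes_inv[OF perm]] permutes_inverses(1)[OF perm] by auto
  moreover have "sigma_perm d \<pi> j = inv \<pi> q - 1"
    using assms by (auto simp: sigma_perm_def q_def)
  ultimately show ?thesis by (auto simp: q_def)
qed

text \<open>The value \<open>d\<close> is taken exactly at the index with \<pi> j = d. Below
  \<open>d\<close>, \<open>sigma_next\<close> recovers \<pi> j and so \<open>j\<close>; 0 is told
  apart because \<pi> is nonzero on {1..d}. An injective self-map of a finite set is onto.\<close>

lemma sigma_permutes:
  assumes "d \<ge> 1"
  shows "sigma_perm d \<pi> permutes {0..d}"
proof (rule bij_imp_permutes)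
  let ?s = "sigma_perm d \<pi>"
  have into: "?s j \<le> d" if "j \<le> d" for j
    using sigma_next[OF assms that] sigma_top[of j] that by (cases "j = 0 \<or> \<pi> j \<noteq> d") auto
  have inj: "inj_on ?s {0..d}"
  proof (rule inj_onI)
    fix i j assume ij: "i \<in> {0..d}" "j \<in> {0..d}" and eq: "?s i = ?s j"
    have top_iff: "?s k = d \<longleftrightarrow> \<not> (k = 0 \<or> \<pi> k \<noteq> d)" if "k \<in> {0..d}" for k
      using sigma_next[OF assms, of k] sigma_top[of k] that by fastforce
    have same: "\<pi> i = \<pi> j \<Longrightarrow> i = j" using permutes_inj[OF perm] by (simp add: inj_eq)
    have pos: "\<pi> k \<noteq> 0" if "k \<in> {0..d}" "k \<noteq> 0" for k
      using perm_in[of k] that by auto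
    show "i = j"
    proof (cases "?s i = d")
      case True
      then show ?thesis using top_iff[OF ij(1)] top_iff[OF ij(2)] eq same by auto
    next
      case False
      then have "i = 0 \<or> \<pi> i \<noteq> d" "j = 0 \<or> \<pi> j \<noteq> d"
        using top_iff[OF ij(1)] top_iff[OF ij(2)] eq by auto
      then have "(if i = 0 then 1 else Suc (\<pi> i)) = (if j = 0 then 1 else Suc (\<pi> j))"
        using sigma_next[OF assms, of i] sigma_next[OF assms, of j] ij eq by simp
      then show ?thesis using same pos[OF ij(1)] pos[OF ij(2)] by (auto split: if_splits)
    qed
  qed
  have "?s ` {0..d} = {0..d}"
    by (rule endo_inj_surj[OF _ _ inj]) (use into in \<open>auto simp: image_subset_iff\<close>)
  then show "bij_betw ?s {0..d} {0..d}" using inj by (simp add: bij_betw_def)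
qed (auto simp: sigma_perm_def)

text \<open>\<sigma> is a permutation, so an orbit of 0 through \<open>d\<close> would be the orbit
  of \<open>d\<close>. An index with \<pi> j = d is sent to \<open>d\<close> and so is excluded as
  well, as \<open>left_translation\<close> requires. \<open>p\<close> is the first return
  time.\<close>

lemma type_W_cycle:
  assumes "d \<ge> 1" "type_W d \<pi>"
  obtains p where "p \<ge> 1" "(sigma_perm d \<pi> ^^ p) 0 = 0"
    "\<And>i. 1 \<le> i \<Longrightarrow> i < p \<Longrightarrow> (sigma_perm d \<pi> ^^ i) 0 \<in> {1..<d}"
    "\<And>i. 1 \<le> i \<Longrightarrow> i < p \<Longrightarrow> \<pi> ((sigma_perm d \<pi> ^^ i) 0) \<noteq> d"
proof -
  let ?s = "sigma_perm d \<pi>"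
  have perm_s: "?s permutes {0..d}" by (rule sigma_permutes[OF assms(1)])
  then have cyc: "cyclic_on ?s (orbit ?s 0)" and self: "0 \<in> orbit ?s 0"
    by (auto intro: cyclic_on_orbit permutation_self_in_orbit permutes_imp_permutation)
  have not_d: "(?s ^^ i) 0 \<noteq> d" if "i \<ge> 1" for i
  proof
    assume "(?s ^^ i) 0 = d"
    then have "d \<in> orbit ?s 0" using that by (auto simp: orbit_altdef intro!: exI[of _ i])
    then show False using orbit_cyclic_eq3[OF cyc] assms(2) by (simp add: type_W_def)
  qed
  have le_d: "(?s ^^ i) 0 \<le> d" for i
    using permutes_in_image[OF perm_s] by (induction i) auto
  define p where "p = (LEAST p. 0 < p \<and> (?s ^^ p) 0 = 0)"
  have "\<exists>p. 0 < p \<and> (?s ^^ p) 0 = 0" using self unfolding orbit_altdef by force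
  from LeastI_ex[OF this] have p: "0 < p" "(?s ^^ p) 0 = 0"
    by (simp_all add: p_def)
  have nz: "(?s ^^ i) 0 \<noteq> 0" if "1 \<le> i" "i < p" for i
    using not_less_Least[of i "\<lambda>p. 0 < p \<and> (?s ^^ p) 0 = 0"] that by (auto simp: p_def)
  show ?thesis
  proof (rule that[of p])
    show in_d: "(?s ^^ i) 0 \<in> {1..<d}" if "1 \<le> i" "i < p" for i
      using nz[OF that] not_d[of i] le_d[of i] that by simp
    show "\<pi> ((?s ^^ i) 0) \<noteq> d" if "1 \<le> i" "i < p" for i
    proof
      assume "\<pi> ((?s ^^ i) 0) = d"
      then have "?s ((?s ^^ i) 0) = d" using in_d[OF that] by (intro sigma_top) auto
      then show False using not_d[of "Suc i"] by simp
    qed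
  qed (use p in auto)
qed

section \<open>Iterated preimages and forward invariant sets\<close>

lemma emeasure_vimage_funpow:
  assumes A: "A \<in> sets lebesgue" "A \<subseteq> {0..<1}"
  shows "{x \<in> {0..<1}. (T ^^ n) x \<in> A} \<in> sets lebesgue \<and>
    emeasure lebesgue {x \<in> {0..<1}. (T ^^ n) x \<in> A} = emeasure lebesgue A"
proof (induction n)
  case 0
  have "{x \<in> {0..<1}. (T ^^ 0) x \<in> A} = A" using A by auto
  then show ?case using A by simp
next
  case (Suc n)
  let ?A = "{x \<in> {0..<1}. (T ^^ n) x \<in> A}"
  have eq: "{x \<in> {0..<1}. (T ^^ Suc n) x \<in> A} = T -` ?A \<inter> {0..<1}"
    by (simp add: set_eq_iff iet_range_iff funpow_swap1 del: atLeastLessThan_iff) blast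
  have A': "?A \<in> sets lebesgue" "?A \<subseteq> {0..<1}" "emeasure lebesgue ?A = emeasure lebesgue A"
    using Suc by blast+
  show ?case
    unfolding eq using emeasure_vimage_iet[OF A'(1,2)] unfolding A'(3) by (rule conjI)
qed

lemma sets_vimage_funpow:
  assumes "A \<in> sets lebesgue" "A \<subseteq> {0..<1}"
  shows "{x \<in> {0..<1}. (T ^^ n) x \<in> A} \<in> sets lebesgue"
  using emeasure_vimage_funpow[OF assms] by blast

lemma measure_vimage_funpow:
  assumes "A \<in> sets lebesgue" "A \<subseteq> {0..<1}"
  shows "measure lebesgue {x \<in> {0..<1}. (T ^^ n) x \<in> A} = measure lebesgue A"
  using emeasure_vimage_funpow[OF assms] by (simp add: measure_def)

lemma measurable_mismatch:
  assumes A: "A \<in> sets lebesgue" "A \<subseteq> {0..<1}"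
  shows "{x \<in> {0..<1}. (T ^^ n) x \<in> A \<longleftrightarrow> x \<notin> A} \<in> lmeasurable"
proof (rule lmeasurable_subset_interval)
  have "{x \<in> {0..<1}. (T ^^ n) x \<in> A \<longleftrightarrow> x \<notin> A} =
      ({x \<in> {0..<1}. (T ^^ n) x \<in> A} - A) \<union> (A - {x \<in> {0..<1}. (T ^^ n) x \<in> A})"
    using A by auto
  then show "{x \<in> {0..<1}. (T ^^ n) x \<in> A \<longleftrightarrow> x \<notin> A} \<in> sets lebesgue"
    using sets_vimage_funpow[OF A, of n] A by simp
qed auto

end

context linearly_recurrent_interval_exchange
begin

text \<open>The iterated preimages of \<open>X\<close> increase and all have the measure of
  \<open>X\<close>, so their union has it too; the union is invariant in both directions, and
  ergodicity applies to it.\<close>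

lemma stable_set_trivial:
  assumes X: "X \<in> sets lebesgue" "X \<subseteq> {0..<1}" and stable: "\<And>x. x \<in> X \<Longrightarrow> T x \<in> X"
  shows "measure lebesgue X = 0 \<or> measure lebesgue X = 1"
proof -
  define Y where "Y m = {x \<in> {0..<1}. (T ^^ m) x \<in> X}" for m
  have Y: "Y m \<in> sets lebesgue" "measure lebesgue (Y m) = measure lebesgue X" "Y m \<subseteq> {0..<1}" for m
    using sets_vimage_funpow[OF X, of m] measure_vimage_funpow[OF X, of m] by (auto simp: Y_def)
  have inc: "incseq Y" by (rule incseq_SucI) (auto simp: Y_def intro: stable)
  have un: "(\<Union>m. Y m) \<in> sets lebesgue" "(\<Union>m. Y m) \<subseteq> {0..<1}" using Y by auto
  have lim: "(\<lambda>m. emeasure lebesgue (Y m)) \<longlonglongrightarrow> emeasure lebesgue (\<Union>m. Y m)"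
    using Y by (intro Lim_emeasure_incseq[OF _ inc]) auto
  have "emeasure lebesgue (Y m) = emeasure lebesgue X" for m
    using emeasure_vimage_funpow[OF X, of m] by (simp add: Y_def)
  then have "emeasure lebesgue (\<Union>m. Y m) = emeasure lebesgue X"
    using LIMSEQ_unique[OF lim] by simp
  moreover have "T z \<in> (\<Union>m. Y m) \<longleftrightarrow> z \<in> (\<Union>m. Y m)" for z
  proof
    assume "T z \<in> (\<Union>m. Y m)"
    then obtain m where m: "T z \<in> {0..<1}" "(T ^^ Suc m) z \<in> X"
      unfolding funpow_Suc_right by (auto simp: Y_def)
    then have "z \<in> Y (Suc m)" using iet_range_iff[of z] unfolding Y_def by blast
    then show "z \<in> (\<Union>m. Y m)" by blast
  next
    assume "z \<in> (\<Union>m. Y m)"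
    then obtain m where m: "z \<in> {0..<1}" "(T ^^ m) z \<in> X" by (auto simp: Y_def)
    then have "(T ^^ Suc m) z \<in> X" using stable by simp
    then have "T z \<in> Y m" using iet_range[OF m(1)] unfolding funpow_Suc_right Y_def by auto
    then show "T z \<in> (\<Union>m. Y m)" by blast
  qed
  ultimately show ?thesis using ergodic[OF un] by (simp add: measure_def)
qed

section \<open>Comparison of orbits along the cycle of \<sigma>\<close>

text \<open>The constants count where the comparison may fail: two uses of \<open>T ^^ n\<close>
  involve \<open>N\<close>, and two translations by \<open>r\<close> involve \<open>R\<close> at
  both of their ends. In each of these six cases the \<open>n\<close> intervals are disjoint, so the
  sum over \<open>k\<close> costs a single measure, without a factor \<open>n\<close>.\<close>

lemma sigma_step:
  fixes A R N :: "real set"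
  assumes N: "N \<in> lmeasurable" "\<And>x. x \<in> {0..<1} \<Longrightarrow> x \<notin> N \<Longrightarrow> (T ^^ n) x \<in> A \<longleftrightarrow> x \<in> A"
    and A: "A \<in> sets lebesgue"
    and R: "R \<in> lmeasurable"
    and const: "\<And>x y. x \<in> {0..<1} - R \<Longrightarrow> y \<in> {0..<1} - R \<Longrightarrow> dist x y < \<rho> \<Longrightarrow> x \<in> A \<longleftrightarrow> y \<in> A"
    and r: "0 < r" "r \<le> gap (2 * n)" "r < \<rho>"
    and j: "j \<in> {1..<d}" "\<pi> j \<noteq> d"
  shows "(\<Sum>k\<in>{1..n}. measure lebesgue
      (mismatch r A ((T ^^ k) (endpoint len j)) ((T ^^ k) (endpoint len (sigma_perm d \<pi> j)))))
    \<le> 2 * measure lebesgue N + 4 * measure lebesgue R"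
proof -
  define \<beta> where "\<beta> = endpoint len j"
  define \<beta>' where "\<beta>' = endpoint len (sigma_perm d \<pi> j)"
  define b where "b = inv (T ^^ n) \<beta>"
  have \<beta>D: "\<beta> \<in> D" using j by (auto simp: \<beta>_def intro: endpoint_in_D)
  have j1: "j \<in> {1..d}" using j by auto
  have \<beta>'D: "\<beta>' \<in> D \<or> \<beta>' = 0"
    using iet_sigma(1)[OF j1 j(2)] by (cases "sigma_perm d \<pi> j = 0") (auto simp: \<beta>'_def intro: endpoint_in_D)
  have Tb: "(T ^^ n) b = \<beta>"
    unfolding b_def by (rule surj_f_inv_f[OF bij_is_surj[OF bij_iet_funpow]])
  have \<beta>01: "\<beta> \<in> {0..<1}" "\<beta>' \<in> {0..<1}" using D_bounds \<beta>D \<beta>'D by force+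
  have b01: "b \<in> {0..<1}"
    using iet_funpow_range_iff[of n b] Tb \<beta>01 by simp
  define bk where "bk k = (T ^^ k) b" for k
  define ck where "ck k = (T ^^ k) \<beta>'" for k
  have bk01: "bk k \<in> {0..<1}" for k
    using iet_funpow_range_iff[of k b] b01 by (simp add: bk_def)
  let ?E = "\<lambda>k. {t \<in> {0..<r}. ((T ^^ k) \<beta> + t \<in> A) \<noteq> ((T ^^ k) \<beta>' + t \<in> A)}"
  let ?W = "\<lambda>k. (window (bk k) r N \<union> window (bk k - r) r N) \<union>
      (window (bk k) r R \<union> window (bk k - r) r R) \<union> (window (ck k - r) r R \<union> window (ck k) r R)"
  have sub: "?E k \<subseteq> ?W k" if k: "k \<in> {1..n}" for k
  proof
    fix t assume t: "t \<in> ?E k"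
    then have t0: "0 \<le> t" "t < r" by auto
    have Tbk: "(T ^^ (n - k)) (bk k) = \<beta>"
      using k Tb by (simp add: bk_def flip: funpow_add[THEN fun_cong, unfolded comp_apply])
    have hit: "(T ^^ (n - k + 0)) (bk k) \<in> D" using Tbk \<beta>D by simp
    have "n - k + 0 \<le> 2 * n" by simp
    note bwd = backward_translation[OF bk01 hit this]
    have b1: "bk k + t \<in> {0..<1}" "bk k - r + t \<in> {0..<1}"
      using bwd(1,2) r t0 by simp_all
    have split_n: "(T ^^ n) z = (T ^^ k) ((T ^^ (n - k)) z)" for z
      using k by (simp flip: funpow_add[THEN fun_cong, unfolded comp_apply])
    have right: "(T ^^ n) (bk k + t) = (T ^^ k) \<beta> + t"
      using bwd(3)[of t] t0 r k forward_translation(2)[of \<beta> k "2 * n" t] \<beta>D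
      by (simp add: split_n Tbk)
    \<comment> \<open>\<open>T ^^ (n - k)\<close> carries the left of \<open>bk k\<close> to the
      left of \<beta>; from there the points follow the orbit of \<beta>' instead of that of
      \<beta>.\<close>
    have "(T ^^ (n - k)) (bk k - r + t) = \<beta> - (r - t)"
      using bwd(3)[of "t - r"] t0 r by (simp add: Tbk algebra_simps)
    then have left: "(T ^^ n) (bk k - r + t) = ck k - r + t"
      using left_translation[OF j, of k "2 * n" "r - t"] t0 r k
      by (simp add: split_n ck_def \<beta>_def \<beta>'_def)
    have c1: "ck k + t \<in> {0..<1}"
    proof -
      have "\<beta>' + t \<in> {0..<1}" using forward_translation(1)[of \<beta>' 0 "2 * n"] \<beta>'D \<beta>01 t0 r by auto
      then show ?thesis
        using iet_funpow_range_iff[of k "\<beta>' + t"] forward_translation(2)[of \<beta>' k "2 * n" t] \<beta>'D t0 r k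
        by (simp add: ck_def)
    qed
    have c2: "ck k - r + t \<in> {0..<1}"
      using iet_funpow_range_iff[of n "bk k - r + t"] b1 left by simp
    show "t \<in> ?W k"
    proof (rule ccontr)
      assume "t \<notin> ?W k"
      then have no: "bk k + t \<notin> N" "bk k - r + t \<notin> N" "bk k + t \<notin> R" "bk k - r + t \<notin> R"
        "ck k - r + t \<notin> R" "ck k + t \<notin> R"
        using t0 by (auto simp: window_iff)
      \<comment> \<open>Back by \<open>T ^^ n\<close> to the right of \<open>bk k\<close>, across to
        its left, forward by \<open>T ^^ n\<close> to the left of \<open>ck k\<close>, and across to
        its right.\<close>
      have "(T ^^ k) \<beta> + t \<in> A \<longleftrightarrow> bk k + t \<in> A" using N(2)[OF b1(1) no(1)] right by simp
      also have "\<dots> \<longleftrightarrow> bk k - r + t \<in> A" using const[of "bk k + t" "bk k - r + t"] b1 no r by (simp add: dist_real_def)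
      also have "\<dots> \<longleftrightarrow> ck k - r + t \<in> A" using N(2)[OF b1(2) no(2)] left by simp
      also have "\<dots> \<longleftrightarrow> ck k + t \<in> A" using const[of "ck k - r + t" "ck k + t"] c1 c2 no r by (simp add: dist_real_def)
      finally show False using t by (simp add: ck_def)
    qed
  qed
  have sep_b: "r \<le> \<bar>bk i - bk k\<bar>" if "i \<in> {1..n}" "k \<in> {1..n}" "i \<noteq> k" for i k
    using orbit_separated[OF b01, of i k "2 * n"] that r by (auto simp: bk_def)
  have sep_c: "r \<le> \<bar>ck i - ck k\<bar>" if "i \<in> {1..n}" "k \<in> {1..n}" "i \<noteq> k" for i k
    using orbit_separated[OF \<beta>01(2), of i k "2 * n"] that r by (auto simp: ck_def)
  have meas: "N \<in> sets lebesgue" "R \<in> sets lebesgue" using N(1) R by (auto dest: fmeasurableD)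
  have W: "?W k \<in> lmeasurable" for k
    by (intro fmeasurable.Un lmeasurable_window meas)
  have E: "?E k \<in> sets lebesgue" for k
    using lmeasurable_mismatch[OF A] by (simp add: mismatch_def fmeasurableD)
  have Un_le: "measure lebesgue (X \<union> Y) \<le> u + v"
    if "measure lebesgue X \<le> u" "measure lebesgue Y \<le> v" "X \<in> sets lebesgue" "Y \<in> sets lebesgue"
    for X Y :: "real set" and u v
    using measure_Un_le[OF that(3,4)] that(1,2) by linarith
  have "(\<Sum>k\<in>{1..n}. measure lebesgue (?E k)) \<le> (\<Sum>k\<in>{1..n}.
      (measure lebesgue (window (bk k) r N) + measure lebesgue (window (bk k - r) r N)) +
      (measure lebesgue (window (bk k) r R) + measure lebesgue (window (bk k - r) r R)) +
      (measure lebesgue (window (ck k - r) r R) + measure lebesgue (window (ck k) r R)))"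
  proof (rule sum_mono)
    fix k assume k: "k \<in> {1..n}"
    have "measure lebesgue (?E k) \<le> measure lebesgue (?W k)"
      by (rule measure_mono_fmeasurable[OF sub[OF k] E W])
    also have "\<dots> \<le> (measure lebesgue (window (bk k) r N) + measure lebesgue (window (bk k - r) r N)) +
      (measure lebesgue (window (bk k) r R) + measure lebesgue (window (bk k - r) r R)) +
      (measure lebesgue (window (ck k - r) r R) + measure lebesgue (window (ck k) r R))"
      by (intro Un_le order_refl sets.Un fmeasurableD lmeasurable_window meas)
    finally show "measure lebesgue (?E k) \<le> \<dots>" .
  qed
  also have "\<dots> \<le> (measure lebesgue N + measure lebesgue N) + (measure lebesgue R + measure lebesgue R) +
      (measure lebesgue R + measure lebesgue R)"
    unfolding sum.distrib
    by (intro add_mono sum_measure_window_le N(1) R finite_atLeastAtMost)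
      (use sep_b sep_c in \<open>simp_all\<close>)
  finally show ?thesis by (simp add: \<beta>_def \<beta>'_def mismatch_def)
qed

text \<open>The triangle inequality chains the steps from \<sigma> 0 around the cycle to 0. The
  remaining step from 0 to \<sigma> 0 is replaced by \<open>T\<close>, which maps endpoint \<sigma>
  0 to 0: the orbit of 0 is thus compared with itself at one time step later.\<close>

lemma type_W_chain:
  fixes A R N :: "real set"
  assumes N: "N \<in> lmeasurable" "\<And>x. x \<in> {0..<1} \<Longrightarrow> x \<notin> N \<Longrightarrow> (T ^^ n) x \<in> A \<longleftrightarrow> x \<in> A"
    and A: "A \<in> sets lebesgue"
    and R: "R \<in> lmeasurable"
    and const: "\<And>x y. x \<in> {0..<1} - R \<Longrightarrow> y \<in> {0..<1} - R \<Longrightarrow> dist x y < \<rho> \<Longrightarrow> x \<in> A \<longleftrightarrow> y \<in> A"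
    and r: "0 < r" "r \<le> gap (2 * n)" "r < \<rho>"
    and p: "p \<ge> 1" "(sigma_perm d \<pi> ^^ p) 0 = 0"
      "\<And>i. 1 \<le> i \<Longrightarrow> i < p \<Longrightarrow> (sigma_perm d \<pi> ^^ i) 0 \<in> {1..<d}"
      "\<And>i. 1 \<le> i \<Longrightarrow> i < p \<Longrightarrow> \<pi> ((sigma_perm d \<pi> ^^ i) 0) \<noteq> d"
  shows "(\<Sum>k<n. measure lebesgue (mismatch r A ((T ^^ k) 0) ((T ^^ Suc k) 0)))
    \<le> real p * (2 * measure lebesgue N + 4 * measure lebesgue R)"
proof -
  define C where "C = 2 * measure lebesgue N + 4 * measure lebesgue R"
  have C: "C \<ge> 0" by (simp add: C_def)
  define s where "s i = endpoint len ((sigma_perm d \<pi> ^^ i) 0)" for i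
  have step: "(\<Sum>k\<in>{1..n}. measure lebesgue (mismatch r A ((T ^^ k) (s i)) ((T ^^ k) (s (Suc i))))) \<le> C"
    if "1 \<le> i" "i < p" for i
    using sigma_step[OF N A R const r p(3)[OF that] p(4)[OF that]] by (simp add: s_def C_def)
  have chain: "(\<Sum>k\<in>{1..n}. measure lebesgue (mismatch r A ((T ^^ k) (s 1)) ((T ^^ k) (s (Suc i))))) \<le> real i * C"
    if "Suc i \<le> p" for i
    using that
  proof (induction i)
    case 0
    then show ?case by (simp add: mismatch_def)
  next
    case (Suc i)
    have "(\<Sum>k\<in>{1..n}. measure lebesgue (mismatch r A ((T ^^ k) (s 1)) ((T ^^ k) (s (Suc (Suc i)))))) \<le>
        (\<Sum>k\<in>{1..n}. measure lebesgue (mismatch r A ((T ^^ k) (s 1)) ((T ^^ k) (s (Suc i)))) +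
          measure lebesgue (mismatch r A ((T ^^ k) (s (Suc i))) ((T ^^ k) (s (Suc (Suc i))))))"
      by (intro sum_mono measure_mismatch_triangle[OF A])
    also have "\<dots> \<le> real i * C + C"
      unfolding sum.distrib by (intro add_mono Suc.IH step) (use Suc.prems in auto)
    finally show ?case by (simp add: algebra_simps)
  qed
  have "s p = 0" by (simp add: s_def p)
  have "T (s 1) = 0" using iet_sigma_0(2) by (simp add: s_def)
  then have shift: "(T ^^ Suc k) (s 1) = (T ^^ k) 0" for k
    unfolding funpow_Suc_right by simp
  have "(\<Sum>k<n. measure lebesgue (mismatch r A ((T ^^ k) 0) ((T ^^ Suc k) 0))) =
      (\<Sum>k\<in>{1..n}. measure lebesgue (mismatch r A ((T ^^ k) (s 1)) ((T ^^ k) (s p))))"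
    unfolding One_nat_def sum.atLeast1_atMost_eq shift[unfolded One_nat_def] \<open>s p = 0\<close> ..
  also have "\<dots> \<le> real (p - 1) * C"
    using chain[of "p - 1"] p(1) by simp
  also have "\<dots> \<le> real p * C" using C by (intro mult_right_mono) auto
  finally show ?thesis
    unfolding C_def .
qed

section \<open>Points that stay on one side of \<open>A\<close>\<close>

text \<open>The finite horizon \<open>L\<close> allows a measure bound to be shown for each
  \<open>L\<close> before the intersection over all \<open>L\<close> is taken.\<close>

definition agree :: "real set \<Rightarrow> nat \<Rightarrow> real set" where
  "agree A L = {x \<in> {0..<1}. \<forall>l\<le>L. (T ^^ l) x \<in> A \<longleftrightarrow> x \<in> A}"

lemma lmeasurable_agree:
  assumes "A \<in> sets lebesgue" "A \<subseteq> {0..<1}"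
  shows "agree A L \<in> lmeasurable"
proof (rule lmeasurable_subset_interval)
  have "agree A L = {0..<1} - (\<Union>l\<in>{..L}. {x \<in> {0..<1}. (T ^^ l) x \<in> A \<longleftrightarrow> x \<notin> A})"
    by (auto simp: agree_def)
  then show "agree A L \<in> sets lebesgue"
    using measurable_mismatch[OF assms] by (auto intro!: sets.Diff sets.finite_UN dest: fmeasurableD)
qed (auto simp: agree_def)

text \<open>A point \<open>(T ^^ k) 0 + t\<close> leaves its side within \<open>L\<close> steps only
  if \<open>t\<close> lies in one of the mismatches number k, ..., k + L - 1. Over the disjoint
  intervals with k < n - L, each mismatch is counted at most \<open>L\<close> times.\<close>

lemma measure_agree_ge:
  assumes A: "A \<in> sets lebesgue" "A \<subseteq> {0..<1}" and r: "0 < r" "r \<le> gap (2 * n)" and "L \<le> n"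
  shows "real (n - L) * r \<le> measure lebesgue (agree A L) +
    real L * (\<Sum>k<n. measure lebesgue (mismatch r A ((T ^^ k) 0) ((T ^^ Suc k) 0)))"
proof -
  define g where "g k = measure lebesgue (mismatch r A ((T ^^ k) 0) ((T ^^ Suc k) 0))" for k
  have g: "g k \<ge> 0" for k by (simp add: g_def)
  have agree: "agree A L \<in> lmeasurable" "agree A L \<in> sets lebesgue"
    using lmeasurable_agree[OF A] by (auto dest: fmeasurableD)
  have window: "r \<le> measure lebesgue (window ((T ^^ k) 0) r (agree A L)) + (\<Sum>l<L. g (k + l))"
    if k: "k < n - L" for k
  proof -
    let ?U = "\<Union>l<L. mismatch r A ((T ^^ (k + l)) 0) ((T ^^ Suc (k + l)) 0)"
    have sub: "{0..<r} \<subseteq> window ((T ^^ k) 0) r (agree A L) \<union> ?U"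
    proof
      fix t assume t: "t \<in> {0..<r}"
      have move: "(T ^^ i) t = (T ^^ i) 0 + t" if "i \<le> n" for i
        using forward_translation(2)[of 0 i "2 * n" t] that t r by simp
      have t01: "t \<in> {0..<1}" using forward_translation(1)[of 0 0 "2 * n"] t r by auto
      show "t \<in> window ((T ^^ k) 0) r (agree A L) \<union> ?U"
      proof (cases "t \<in> ?U")
        case False
        have same: "(T ^^ (k + l)) 0 + t \<in> A \<longleftrightarrow> (T ^^ k) 0 + t \<in> A" if "l \<le> L" for l
          using that
        proof (induction l)
          case (Suc l)
          then have "t \<notin> mismatch r A ((T ^^ (k + l)) 0) ((T ^^ Suc (k + l)) 0)" using False by auto
          then show ?case using Suc t by (simp add: mismatch_def)
        qed simp
        have "(T ^^ l) ((T ^^ k) 0 + t) = (T ^^ (k + l)) 0 + t" if "l \<le> L" for l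
        proof -
          have "(T ^^ l) ((T ^^ k) 0 + t) = (T ^^ l) ((T ^^ k) t)" using move[of k] k by simp
          also have "\<dots> = (T ^^ (k + l)) t" by (simp add: funpow_add add.commute[of k])
          finally show ?thesis using move[of "k + l"] k that by simp
        qed
        moreover have "(T ^^ k) 0 + t \<in> {0..<1}"
          using iet_funpow_range_iff[of k t] t01 move[of k] k by simp
        ultimately have "(T ^^ k) 0 + t \<in> agree A L" using same by (simp add: agree_def)
        then show ?thesis using t by (simp add: window_iff)
      qed simp
    qed
    have U: "?U \<in> lmeasurable" by (intro fmeasurable.finite_UN lmeasurable_mismatch A(1)) auto
    have W: "window ((T ^^ k) 0) r (agree A L) \<in> lmeasurable" by (rule lmeasurable_window[OF agree(2)])
    have "r = measure lebesgue {0..<r}" using r by simp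
    also have "\<dots> \<le> measure lebesgue (window ((T ^^ k) 0) r (agree A L) \<union> ?U)"
      by (rule measure_mono_fmeasurable[OF sub _ fmeasurable.Un[OF W U]]) auto
    also have "\<dots> \<le> measure lebesgue (window ((T ^^ k) 0) r (agree A L)) + measure lebesgue ?U"
      by (intro measure_Un_le fmeasurableD W U)
    also have "measure lebesgue ?U \<le> (\<Sum>l<L. g (k + l))"
      unfolding g_def by (intro measure_UNION_le fmeasurableD lmeasurable_mismatch A(1)) auto
    finally show ?thesis by simp
  qed
  have "real (n - L) * r = (\<Sum>k<n - L. r)" by simp
  also have "\<dots> \<le> (\<Sum>k<n - L. measure lebesgue (window ((T ^^ k) 0) r (agree A L)) + (\<Sum>l<L. g (k + l)))"
    by (intro sum_mono window) simp
  also have "\<dots> = (\<Sum>k<n - L. measure lebesgue (window ((T ^^ k) 0) r (agree A L))) + (\<Sum>l<L. \<Sum>k<n - L. g (k + l))"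
    by (simp add: sum.distrib sum.swap[of _ "{..<L}"])
  also have "\<dots> \<le> measure lebesgue (agree A L) + (\<Sum>l<L. \<Sum>k<n. g k)"
  proof (intro add_mono sum_mono)
    show "(\<Sum>k<n - L. measure lebesgue (window ((T ^^ k) 0) r (agree A L))) \<le> measure lebesgue (agree A L)"
    proof (rule sum_measure_window_le[OF _ agree(1)])
      fix i j assume ij: "i \<in> {..<n - L}" "j \<in> {..<n - L}" "i \<noteq> j"
      then have "2 * i \<le> 2 * n" "2 * j \<le> 2 * n" by auto
      then show "r \<le> \<bar>(T ^^ i) 0 - (T ^^ j) 0\<bar>"
        using orbit_separated[of 0 i j "2 * n"] r ij by auto
    qed simp
    fix l assume l: "l \<in> {..<L}"
    have "(\<Sum>k<n - L. g (k + l)) = sum g ((\<lambda>k. k + l) ` {..<n - L})"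
      by (simp add: sum.reindex)
    also have "\<dots> \<le> (\<Sum>k<n. g k)"
      by (rule sum_mono2) (use l g in auto)
    finally show "(\<Sum>k<n - L. g (k + l)) \<le> (\<Sum>k<n. g k)" .
  qed
  finally show ?thesis by (simp add: g_def)
qed

text \<open>The bound is independent of \<open>L\<close>: a larger \<open>L\<close> only calls for a
  smaller \<eta> and a later member of the sequence, and the loss stays at most c / 16 out of c /
  8.\<close>

lemma measure_agree_bound:
  assumes W: "type_W d \<pi>" and A: "A \<in> sets lebesgue" "A \<subseteq> {0..<1}"
    and m: "filterlim m at_top sequentially"
    and lim: "(\<lambda>i. measure lebesgue {x \<in> {0..<1}. (T ^^ m i) x \<in> A \<longleftrightarrow> x \<notin> A}) \<longlonglongrightarrow> 0"
  shows "c / 16 \<le> measure lebesgue (agree A L)"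
proof -
  have "d \<ge> 1" using d_ge_2 by simp
  then obtain p where p: "p \<ge> 1" "(sigma_perm d \<pi> ^^ p) 0 = 0"
      "\<And>i. 1 \<le> i \<Longrightarrow> i < p \<Longrightarrow> (sigma_perm d \<pi> ^^ i) 0 \<in> {1..<d}"
      "\<And>i. 1 \<le> i \<Longrightarrow> i < p \<Longrightarrow> \<pi> ((sigma_perm d \<pi> ^^ i) 0) \<noteq> d"
    using type_W_cycle[OF _ W] by metis
  \<comment> \<open>The factor 6 collects the 2 and 4 of \<open>type_W_chain\<close>: the sum of the
    mismatches is at most p * 6 \<eta> = c / (16 (L + 1)), and \<open>L\<close> times that is at
    most c / 16.\<close>
  define \<eta> where "\<eta> = c / (16 * (real L + 1)) / (6 * real p)"
  have \<eta>: "\<eta> > 0" using c_pos p(1) by (simp add: \<eta>_def)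
  have unit: "{0..<1::real} \<in> sets lebesgue" "bounded {0..<1::real}" by auto
  obtain R \<rho> where R: "R \<in> lmeasurable" "measure lebesgue R < \<eta>" and \<rho>: "\<rho> > 0"
    and const: "\<And>x y. x \<in> {0..<1} - R \<Longrightarrow> y \<in> {0..<1} - R \<Longrightarrow> dist x y < \<rho> \<Longrightarrow> x \<in> A \<longleftrightarrow> y \<in> A"
    by (rule almost_locally_constant[OF A unit \<eta>], rule that)
  let ?N = "\<lambda>n. {x \<in> {0..<1}. (T ^^ n) x \<in> A \<longleftrightarrow> x \<notin> A}"
  have "eventually (\<lambda>i. measure lebesgue (?N (m i)) < \<eta>) sequentially"
    using order_tendstoD(2)[OF lim \<eta>] .
  moreover have "eventually (\<lambda>i. m i \<ge> max (2 * L + 1) (nat \<lceil>c / \<rho>\<rceil> + 1)) sequentially"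
    using m unfolding filterlim_at_top by blast
  ultimately have "eventually (\<lambda>i. measure lebesgue (?N (m i)) < \<eta> \<and>
      m i \<ge> max (2 * L + 1) (nat \<lceil>c / \<rho>\<rceil> + 1)) sequentially"
    by (rule eventually_conj)
  then obtain i where i: "measure lebesgue (?N (m i)) < \<eta>" "m i \<ge> max (2 * L + 1) (nat \<lceil>c / \<rho>\<rceil> + 1)"
    unfolding eventually_sequentially by blast
  define n where "n = m i"
  have n: "n \<ge> 1" "2 * L \<le> n" "c / \<rho> < real n" "measure lebesgue (?N n) < \<eta>"
    using i unfolding n_def by (auto simp: nat_ceiling_le_eq) linarith
  \<comment> \<open>Half of the lower bound c / (2 n) for \<open>gap (2 * n)\<close>. As n is at
    least 2 L, the n - L intervals of this length still have total length at least c / 8.\<close>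
  define r where "r = c / (4 * real n)"
  have r: "0 < r" "r < \<rho>" using c_pos n \<rho> by (auto simp: r_def field_simps)
  have rgap: "r \<le> gap (2 * n)"
  proof -
    have "real (2 * n) * r \<le> c" using n c_pos by (simp add: r_def)
    also have "c \<le> real (2 * n) * gap (2 * n)" using n by (intro c_le_gap) auto
    finally show ?thesis using n by (subst (asm) mult_le_cancel_left_pos) auto
  qed
  let ?S = "\<Sum>k<n. measure lebesgue (mismatch r A ((T ^^ k) 0) ((T ^^ Suc k) 0))"
  have "?S \<le> real p * (2 * measure lebesgue (?N n) + 4 * measure lebesgue R)"
    by (rule type_W_chain[OF measurable_mismatch[OF A] _ A(1) R(1) const r(1) rgap r(2) p]) auto
  also have "\<dots> \<le> real p * (6 * \<eta>)"
    using n(4) R(2) by (intro mult_left_mono) auto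
  finally have "real L * ?S \<le> real L * (real p * (6 * \<eta>))"
    by (rule mult_left_mono) simp
  also have "real p * (6 * \<eta>) = c / (16 * (real L + 1))"
    using p(1) by (simp add: \<eta>_def)
  also have "real L * \<dots> = c / 16 * (real L / (real L + 1))"
    by simp
  also have "\<dots> \<le> c / 16 * 1"
    using c_pos by (intro mult_left_mono) auto
  finally have S: "real L * ?S \<le> c / 16" by simp
  have "c / 8 = (real n / 2) * r" using n by (simp add: r_def)
  also have "\<dots> \<le> real (n - L) * r"
    using n r by (intro mult_right_mono) auto
  also have "\<dots> \<le> measure lebesgue (agree A L) + real L * ?S"
    by (rule measure_agree_ge[OF A r(1) rgap]) (use n in auto)
  finally show ?thesis using S by simp
qed

text \<open>The uniform bound survives the intersection \<open>G\<close> over all \<open>L\<close>.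
  Points of \<open>G\<close> keep their side forever, so \<open>G \<inter> A\<close> and
  \<open>G - A\<close> are mapped into themselves and have measure 0 or 1; not both are
  null.\<close>

theorem rigid_set_trivial:
  assumes W: "type_W d \<pi>" and A: "A \<in> sets lebesgue" "A \<subseteq> {0..<1}"
    and m: "filterlim m at_top sequentially"
    and lim: "(\<lambda>i. measure lebesgue {x \<in> {0..<1}. (T ^^ m i) x \<in> A \<longleftrightarrow> x \<notin> A}) \<longlonglongrightarrow> 0"
  shows "measure lebesgue A = 0 \<or> measure lebesgue A = 1"
proof -
  define G where "G = (\<Inter>L. agree A L)"
  have G_iff: "x \<in> G \<longleftrightarrow> x \<in> {0..<1} \<and> (\<forall>l. (T ^^ l) x \<in> A \<longleftrightarrow> x \<in> A)" for x
    by (auto simp: G_def agree_def)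
  have meas: "agree A L \<in> sets lebesgue" for L using lmeasurable_agree[OF A] by (rule fmeasurableD)
  have G: "G \<in> sets lebesgue" "G \<subseteq> {0..<1}"
    using meas G_iff by (auto simp: G_def)
  have "(\<lambda>L. emeasure lebesgue (agree A L)) \<longlonglongrightarrow> emeasure lebesgue G"
    unfolding G_def
  proof (rule Lim_emeasure_decseq)
    show "decseq (agree A)" by (rule decseq_SucI) (auto simp: agree_def)
    show "emeasure lebesgue (agree A L) \<noteq> \<infinity>" for L
      using emeasure_eq_measure2[OF lmeasurable_agree[OF A]] by simp
  qed (use meas in auto)
  moreover have "ennreal (c / 16) \<le> emeasure lebesgue (agree A L)" for L
    using measure_agree_bound[OF assms, of L] emeasure_eq_measure2[OF lmeasurable_agree[OF A]]
    by (simp add: ennreal_leI)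
  ultimately have "ennreal (c / 16) \<le> emeasure lebesgue G"
    by (intro LIMSEQ_le_const) auto
  then have G_pos: "measure lebesgue G > 0"
    using emeasure_eq_measure2[OF lmeasurable_subset_interval[OF G]] c_pos
    by (simp add: ennreal_le_iff)
  have G1: "measure lebesgue (G \<inter> A) = 0 \<or> measure lebesgue (G \<inter> A) = 1"
  proof (rule stable_set_trivial)
    fix x assume x: "x \<in> G \<inter> A"
    have "(T ^^ l) (T x) \<in> A" for l
      using x G_iff[of x] by (simp flip: funpow_swap1) (metis funpow.simps(2) comp_apply)
    then show "T x \<in> G \<inter> A" using x G_iff[of "T x"] G_iff[of x] iet_range[of x]
      by (metis Int_iff funpow_0)
  qed (use G A in auto)
  have G0: "measure lebesgue (G - A) = 0 \<or> measure lebesgue (G - A) = 1"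
  proof (rule stable_set_trivial)
    fix x assume x: "x \<in> G - A"
    have "(T ^^ l) (T x) \<notin> A" for l
      using x G_iff[of x] by (simp flip: funpow_swap1) (metis funpow.simps(2) comp_apply)
    then show "T x \<in> G - A" using x G_iff[of "T x"] G_iff[of x] iet_range[of x]
      by (metis Diff_iff funpow_0)
  qed (use G A in auto)
  have lA: "A \<in> lmeasurable" using A by (rule lmeasurable_subset_interval)
  have compl: "measure lebesgue ({0..<1} - A) = 1 - measure lebesgue A"
    using measurable_measure_Diff[of "{0..<1}" lebesgue A] A by simp
  have lC: "{0..<1} - A \<in> lmeasurable" using A by (intro fmeasurable_Diff) auto
  have "measure lebesgue G \<le> measure lebesgue (G \<inter> A) + measure lebesgue (G - A)"
    using measure_Un_le[of "G \<inter> A" lebesgue "G - A"] G A by (simp add: Int_Diff_Un)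
  then consider "measure lebesgue (G \<inter> A) = 1" | "measure lebesgue (G - A) = 1"
    using G_pos G0 G1 by linarith
  then show ?thesis
  proof cases
    case 1
    have "measure lebesgue (G \<inter> A) \<le> measure lebesgue A"
      by (rule measure_mono_fmeasurable[OF _ _ lA]) (use G A in auto)
    moreover have "0 \<le> measure lebesgue ({0..<1} - A)" by simp
    ultimately show ?thesis using 1 compl by linarith
  next
    case 2
    have "measure lebesgue (G - A) \<le> measure lebesgue ({0..<1} - A)"
      by (rule measure_mono_fmeasurable[OF _ _ lC]) (use G A in auto)
    moreover have "0 \<le> measure lebesgue A" by simp
    ultimately show ?thesis using 2 compl by linarith
  qed
qed

end

section \<open>Rigid factors\<close>

lemma measure_preserving_funpow:
  assumes "measure_preserving_map M M T"
  shows "measure_preserving_map M M (T ^^ n)"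
proof (induction n)
  case 0
  have "distr M M (\<lambda>x. x) = M" by (rule distr_id2) simp
  then show ?case by (simp add: measure_preserving_map_def id_def)
next
  case (Suc n)
  have "distr M M (T \<circ> T ^^ n) = distr (distr M M (T ^^ n)) M T"
    using assms Suc by (intro distr_distr[symmetric]) (auto simp: measure_preserving_map_def)
  also have "\<dots> = M" using assms Suc by (simp add: measure_preserving_map_def)
  finally have "distr M M (T \<circ> T ^^ n) = M" .
  moreover have "T \<circ> T ^^ n \<in> measurable M M"
    using assms Suc by (intro measurable_comp[of _ _ M]) (auto simp: measure_preserving_map_def)
  ultimately show ?case unfolding funpow.simps measure_preserving_map_def by simp
qed

text \<open>As \<open>T ^^ n\<close> preserves the measure, the points that it sends into the
  exceptional null set form a null set again.\<close>

lemma factor_map_funpow: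
  assumes T: "measure_preserving_map M M T" and AE: "AE x in M. \<phi> (T x) = S (\<phi> x)"
  shows "AE x in M. \<phi> ((T ^^ n) x) = (S ^^ n) (\<phi> x)"
proof (induction n)
  case (Suc n)
  have Tn: "T ^^ n \<in> measurable M M" "distr M M (T ^^ n) = M"
    using measure_preserving_funpow[OF T, of n] by (auto simp: measure_preserving_map_def)
  have "AE x in distr M M (T ^^ n). \<phi> (T x) = S (\<phi> x)" using AE unfolding Tn(2) .
  then have "AE x in M. \<phi> (T ((T ^^ n) x)) = S (\<phi> ((T ^^ n) x))" by (rule AE_distrD[OF Tn(1)])
  with Suc show ?case by eventually_elim simp
qed simp

text \<open>For the indicator of \<open>C\<close>, the squared L2 distance is the measure of the
  symmetric difference of \<open>C\<close> and its preimage under the iterate. One sequence serves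
  all sets.\<close>

lemma rigid_indicator:
  assumes "rigid N S"
  obtains m :: "nat \<Rightarrow> nat" where "filterlim m at_top sequentially"
    "\<And>C. C \<in> sets N \<Longrightarrow> (\<lambda>i. emeasure N {y \<in> space N. (S ^^ m i) y \<in> C \<longleftrightarrow> y \<notin> C}) \<longlonglongrightarrow> 0"
proof -
  obtain m :: "nat \<Rightarrow> nat" where m: "filterlim m at_top sequentially"
    and conv: "\<And>f. square_integrable N f \<Longrightarrow> L2_tendsto N (\<lambda>i. f \<circ> (S ^^ m i)) f"
    and mp: "mp_transformation N S"
    using assms unfolding rigid_def by blast
  interpret prob_space N using mp by (simp add: mp_transformation_def)
  show ?thesis
  proof (rule that[OF m])
    fix C assume C: "C \<in> sets N"
    have "square_integrable N (indicator C :: _ \<Rightarrow> complex)"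
    proof -
      have eq: "(cmod (indicator C x))\<^sup>2 = indicator C x" for x by (simp add: indicator_def)
      show ?thesis unfolding square_integrable_def eq using C by (auto simp: emeasure_eq_measure)
    qed
    from conv[OF this] have "(\<lambda>i. \<integral>\<^sup>+ y. ennreal ((cmod ((indicator C \<circ> (S ^^ m i)) y - indicator C y))\<^sup>2) \<partial>N) \<longlonglongrightarrow> 0"
      by (simp add: L2_tendsto_def)
    moreover have "(\<integral>\<^sup>+ y. ennreal ((cmod ((indicator C \<circ> (S ^^ m i)) y - indicator C y))\<^sup>2) \<partial>N) =
        emeasure N {y \<in> space N. (S ^^ m i) y \<in> C \<longleftrightarrow> y \<notin> C}" (is "?I i = emeasure N (?E i)") for i
    proof -
      have [measurable]: "S ^^ m i \<in> measurable N N"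
        using measure_preserving_funpow mp by (auto simp: mp_transformation_def measure_preserving_map_def)
      have E: "?E i \<in> sets N" using C by measurable
      have "?I i = (\<integral>\<^sup>+ y. indicator (?E i) y \<partial>N)"
        by (rule nn_integral_cong) (auto simp: indicator_def)
      also have "\<dots> = emeasure N (?E i)" using E by simp
      finally show ?thesis .
    qed
    ultimately show "(\<lambda>i. emeasure N (?E i)) \<longlonglongrightarrow> 0" by simp
  qed
qed

text \<open>The witness is the preimage under the factor map of a set with measure other than 0 and
  1. Its symmetric differences agree almost everywhere with the preimages of those in the
  factor.\<close>

lemma rigid_factor_set:
  assumes "is_factor M T N S" "rigid N S" "\<not> trivial_space N"
  obtains A and m :: "nat \<Rightarrow> nat" where "A \<in> sets M" "measure M A \<noteq> 0" "measure M A \<noteq> 1"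
    "filterlim m at_top sequentially"
    "(\<lambda>i. measure M {x \<in> space M. (T ^^ m i) x \<in> A \<longleftrightarrow> x \<notin> A}) \<longlonglongrightarrow> 0"
proof -
  obtain \<phi> where T: "mp_transformation M T" and S: "mp_transformation N S"
    and \<phi>: "\<phi> \<in> measurable M N" "distr M N \<phi> = N" and AE: "AE x in M. \<phi> (T x) = S (\<phi> x)"
    using assms(1) unfolding is_factor_def measure_preserving_map_def by blast
  interpret prob_space M using T by (simp add: mp_transformation_def)
  obtain C where C: "C \<in> sets N" "measure N C \<noteq> 0" "measure N C \<noteq> 1"
    using assms(3) by (auto simp: trivial_space_def)
  obtain m :: "nat \<Rightarrow> nat" where m: "filterlim m at_top sequentially"
    and lim: "\<And>C. C \<in> sets N \<Longrightarrow> (\<lambda>i. emeasure N {y \<in> space N. (S ^^ m i) y \<in> C \<longleftrightarrow> y \<notin> C}) \<longlonglongrightarrow> 0"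
    using rigid_indicator[OF assms(2)] by blast
  define A where "A = \<phi> -` C \<inter> space M"
  have A: "A \<in> sets M" unfolding A_def using \<phi> C by (auto intro: measurable_sets)
  have "measure N C = measure M A"
    using measure_distr[OF \<phi>(1) C(1)] by (simp add: \<phi>(2) A_def)
  moreover have "(\<lambda>i. measure M {x \<in> space M. (T ^^ m i) x \<in> A \<longleftrightarrow> x \<notin> A}) \<longlonglongrightarrow> 0"
  proof -
    have eq: "emeasure M {x \<in> space M. (T ^^ n) x \<in> A \<longleftrightarrow> x \<notin> A} =
        emeasure N {y \<in> space N. (S ^^ n) y \<in> C \<longleftrightarrow> y \<notin> C}" (is "emeasure M (?F n) = emeasure N (?E n)") for n
    proof -
      have Sn [measurable]: "S ^^ n \<in> measurable N N" and Tn [measurable]: "T ^^ n \<in> measurable M M"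
        using measure_preserving_funpow S T by (auto simp: mp_transformation_def measure_preserving_map_def)
      have E: "?E n \<in> sets N" using C by measurable
      have F: "?F n \<in> sets M" using A by measurable
      have pre: "\<phi> -` ?E n \<inter> space M \<in> sets M" using \<phi>(1) E by (rule measurable_sets)
      have "AE x in M. \<phi> ((T ^^ n) x) = (S ^^ n) (\<phi> x)"
        by (rule factor_map_funpow[OF _ AE]) (use T in \<open>simp add: mp_transformation_def\<close>)
      then have "AE x in M. x \<in> ?F n \<longleftrightarrow> x \<in> \<phi> -` ?E n \<inter> space M"
        using AE_space
      proof eventually_elim
        case (elim x)
        then show ?case
          using measurable_space[OF \<phi>(1)] measurable_space[OF Tn] by (auto simp: A_def)
      qed
      then have "emeasure M (?F n) = emeasure M (\<phi> -` ?E n \<inter> space M)"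
        using F pre by (rule emeasure_eq_AE)
      also have "\<dots> = emeasure N (?E n)"
        using emeasure_distr[OF \<phi>(1) E] by (simp add: \<phi>(2))
      finally show ?thesis .
    qed
    have "(\<lambda>i. enn2real (emeasure M {x \<in> space M. (T ^^ m i) x \<in> A \<longleftrightarrow> x \<notin> A})) \<longlonglongrightarrow> 0"
      unfolding eq by (rule tendsto_enn2real) (use lim[OF C(1)] in simp_all)
    then show ?thesis by (simp add: measure_def)
  qed
  ultimately show ?thesis using that[OF A _ _ m] C by simp
qed

theorem theorem8:
  fixes d :: nat and \<pi> :: "nat \<Rightarrow> nat" and len :: "nat \<Rightarrow> real"
  assumes "d \<ge> 2"
    and "\<pi> permutes {1..d}"
    and "irreducible_perm d \<pi>"
    and "type_W d \<pi>"
    and "\<And>i. i \<in> {1..d} \<Longrightarrow> len i > 0"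
    and "(\<Sum>i\<in>{1..d}. len i) = 1"
    and "linearly_recurrent d \<pi> len"
  shows "mildly_mixing TYPE('b) (lebesgue_on {0..<1}) (iet d \<pi> len)"
proof -
  interpret idoc_interval_exchange d len \<pi>
    using assms by unfold_locales (auto simp: linearly_recurrent_def)
  obtain c where c: "c > 0" "c \<le> (INF n\<in>{1..}. real n * gap n)"
    using assms(7) by (auto simp: linearly_recurrent_def)
  \<comment> \<open>Over the reals \<open>INF\<close> is known to lie below its members only when
    these are bounded below.\<close>
  have bdd: "bdd_below ((\<lambda>n. real n * gap n) ` {1..})"
    by (rule bdd_belowI[of _ 0]) (auto intro!: mult_nonneg_nonneg less_imp_le[OF gap_pos])
  interpret linearly_recurrent_interval_exchange d len \<pi> c
  proof
    fix n :: nat assume "1 \<le> n"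
    then have "(INF n\<in>{1..}. real n * gap n) \<le> real n * gap n"
      by (intro cINF_lower[OF bdd]) simp
    then show "c \<le> real n * gap n" using c(2) by linarith
  qed (fact c(1))
  let ?M = "lebesgue_on {0..<1::real}"
  have "False" if factor: "is_factor ?M T N S" "rigid N S" "\<not> trivial_space N" for N :: "'b measure" and S
  proof -
    obtain A and m :: "nat \<Rightarrow> nat" where A: "A \<in> sets ?M" "measure ?M A \<noteq> 0" "measure ?M A \<noteq> 1"
      and m: "filterlim m at_top sequentially"
      and lim: "(\<lambda>i. measure ?M {x \<in> space ?M. (T ^^ m i) x \<in> A \<longleftrightarrow> x \<notin> A}) \<longlonglongrightarrow> 0"
      by (rule rigid_factor_set[OF factor], rule that)
    have restrict: "measure ?M X = measure lebesgue X" if "X \<subseteq> {0..<1}" for X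
      using that by (intro measure_restrict_space) auto
    have A': "A \<in> sets lebesgue" "A \<subseteq> {0..<1}"
      using A(1) by (auto simp: sets_restrict_space_iff)
    have "(\<lambda>i. measure lebesgue {x \<in> {0..<1}. (T ^^ m i) x \<in> A \<longleftrightarrow> x \<notin> A}) \<longlonglongrightarrow> 0"
      using lim by (subst (asm) restrict) auto
    from rigid_set_trivial[OF assms(4) A' m this] A(2,3) restrict[OF A'(2)] show False by simp
  qed
  then show ?thesis
    unfolding mildly_mixing_def using mp_transformation_iet by blast
qed

end
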